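(* Let $M$ be a matroid of rank $r$ and let $(A_1,A_2)$ and $(B_1,B_2)$ be compatible pairs of bases of $M$, that is, $A_1\cap A_2=B_1\cap B_2$ and $A_1\cup A_2=B_1\cup B_2$. Then there exists a strictly monotone sequence of symmetric exchanges for $(A_1,A_2)$ and $(B_1,B_2)$ of length at least (a) $r-3|A_1\cap B_1|$, if $M$ is a split matroid; (b) $r-2|A_1\cap B_1|$, if $M$ is a base orderable split matroid; (c) $r-|A_1\cap B_1|-2$, if $M$ is a paving matroid.
   Context: All matroids are on finite ground sets. For a set $X$ and elements $e,f$, write $X-e=X\setminus\{e\}$ and $X+f=X\cup\{f\}$; $X-Y$ denotes set difference. Symmetric exchange: let $(X_1,X_2)$ be an ordered pair of bases of a matroid $M$. If $e\in X_1-X_2$ and $f\in X_2-X_1$ are such that both $X_1-e+f$ and $X_2+e-f$ are bases of $M$, then the pair $(X_1-e+f,\,X_2+e-f)$ is said to be obtained from $(X_1,X_2)$ by a symmetric exchange. A strictly monotone sequence for $(A_1,A_2)$ and $(B_1,B_2)$ of length $t$ is a sequence of $t\ge 0$ successive symmetric exchanges starting from $(A_1,A_2)$, such that each step strictly decreases the difference $|X_1-B_1|$ between the first member $X_1$ of the current pair and $B_1$ (the sequence is not required to reach $(B_1,B_2)$). A matroid is base orderable if for any two bases $A,B$ there exists a bijection $\varphi\colon A\to B$ such that $A-e+\varphi(e)$ and $B-\varphi(e)+e$ are bases for every $e\in A$. A matroid of rank $r$ is paving if every set of size at most $r-1$ is independent. Elementary split matroid: let $S$ be a finite set, $r,r_1,\dots,r_q$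 ($q\ge 0$) non-negative integers with $|S|\ge r$, and $H_1,\dots,H_q\subseteq S$ subsets such that $|H_i\cap H_j|\le r_i+r_j-r$ for all $1\le i<j\le q$, and $|S-H_i|+r_i\ge r$ for all $i$. Then $\{X\subseteq S : |X|\le r,\ |X\cap H_i|\le r_i \text{ for } 1\le i\le q\}$ is the family of independent sets of a rank-$r$ matroid on $S$; matroids arising this way are called elementary split matroids. Split matroid: a matroid is a split matroid if at most one of its connected components is a non-uniform matroid, and this component, if it exists, is an elementary split matroid (all other components being uniform matroids). *)

theory Defs
  imports Main
begin

text \<open>
  A matroid is given by its finite ground set \<open>S\<close> and its family \<open>I\<close> of independent sets.
\<close>

locale matroid =
  fixes S :: "'a set" and I :: "'a set set"
  assumes finite_ground: "finite S"
    and indep_subset_ground: "X \<in> I \<Longrightarrow> X \<subseteq> S"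
    and indep_empty: "{} \<in> I"
    and indep_subset: "X \<in> I \<Longrightarrow> Y \<subseteq> X \<Longrightarrow> Y \<in> I"
    and augmentation:
      "X \<in> I \<Longrightarrow> Y \<in> I \<Longrightarrow> card X < card Y \<Longrightarrow> \<exists>y\<in>Y - X. insert y X \<in> I"

definition bases :: "'a set set \<Rightarrow> 'a set set" where
  "bases I = {B \<in> I. \<forall>X\<in>I. B \<subseteq> X \<longrightarrow> X = B}"

definition mrank :: "'a set set \<Rightarrow> nat" where
  "mrank I = Max (card ` I)"

definition circuit :: "'a set \<Rightarrow> 'a set set \<Rightarrow> 'a set \<Rightarrow> bool" where
  "circuit S I C \<longleftrightarrow> C \<subseteq> S \<and> C \<notin> I \<and> (\<forall>D. D \<subset> C \<longrightarrow> D \<in> I)"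

definition restriction :: "'a set set \<Rightarrow> 'a set \<Rightarrow> 'a set set" where
  "restriction I C = {X \<in> I. X \<subseteq> C}"

text \<open>
  For a matroid, lying on a common circuit (or being equal) is an equivalence relation on the
  ground set, and its classes are the ground sets of the connected components.
  Every loop and every coloop forms a component of its own.
\<close>

definition same_component :: "'a set \<Rightarrow> 'a set set \<Rightarrow> ('a \<times> 'a) set" where
  "same_component S I =
    {(e, f). e \<in> S \<and> f \<in> S \<and> (e = f \<or> (\<exists>C. circuit S I C \<and> e \<in> C \<and> f \<in> C))}"

definition matroid_components :: "'a set \<Rightarrow> 'a set set \<Rightarrow> 'a set set" where
  "matroid_components S I = S // same_component S I"

definition uniform :: "'a set \<Rightarrow> 'a set set \<Rightarrow> bool" where
  "uniform S I \<longleftrightarrow> (\<exists>k \<le> card S. I = {X. X \<subseteq> S \<and> card X \<le> k})"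

text \<open>
  The right-hand side \<open>r\<^sub>i + r\<^sub>j - r\<close> may be negative, hence the conversion to integers.
\<close>

definition elementary_split :: "'a set \<Rightarrow> 'a set set \<Rightarrow> bool" where
  "elementary_split S I \<longleftrightarrow>
    (\<exists>(r::nat) (q::nat) (rs :: nat \<Rightarrow> nat) (H :: nat \<Rightarrow> 'a set).
       finite S \<and> r \<le> card S \<and>
       (\<forall>i\<in>{1..q}. H i \<subseteq> S) \<and>
       (\<forall>i\<in>{1..q}. \<forall>j\<in>{1..q}. i < j \<longrightarrow>
          int (card (H i \<inter> H j)) \<le> int (rs i) + int (rs j) - int r) \<and>
       (\<forall>i\<in>{1..q}. r \<le> card (S - H i) + rs i) \<and>
       I = {X. X \<subseteq> S \<and> card X \<le> r \<and> (\<forall>i\<in>{1..q}. card (X \<inter> H i) \<le> rs i)})"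

definition split_matroid :: "'a set \<Rightarrow> 'a set set \<Rightarrow> bool" where
  "split_matroid S I \<longleftrightarrow> matroid S I \<and>
    (\<forall>C\<in>matroid_components S I. \<forall>D\<in>matroid_components S I.
       \<not> uniform C (restriction I C) \<and> \<not> uniform D (restriction I D) \<longrightarrow> C = D) \<and>
    (\<forall>C\<in>matroid_components S I.
       \<not> uniform C (restriction I C) \<longrightarrow> elementary_split C (restriction I C))"

definition base_orderable :: "'a set set \<Rightarrow> bool" where
  "base_orderable I \<longleftrightarrow>
    (\<forall>A\<in>bases I. \<forall>B\<in>bases I. \<exists>\<phi>. bij_betw \<phi> A B \<and>
       (\<forall>e\<in>A. insert (\<phi> e) (A - {e}) \<in> bases I \<and> insert e (B - {\<phi> e}) \<in> bases I))"

definition paving :: "'a set \<Rightarrow> 'a set set \<Rightarrow> bool" where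
  "paving S I \<longleftrightarrow> (\<forall>X. X \<subseteq> S \<and> card X < mrank I \<longrightarrow> X \<in> I)"

definition compatible :: "'a set \<times> 'a set \<Rightarrow> 'a set \<times> 'a set \<Rightarrow> bool" where
  "compatible A B \<longleftrightarrow>
    fst A \<inter> snd A = fst B \<inter> snd B \<and> fst A \<union> snd A = fst B \<union> snd B"

definition symmetric_exchange ::
  "'a set set \<Rightarrow> 'a set \<times> 'a set \<Rightarrow> 'a set \<times> 'a set \<Rightarrow> bool" where
  "symmetric_exchange I X Y \<longleftrightarrow>
    X \<in> bases I \<times> bases I \<and> Y \<in> bases I \<times> bases I \<and>
    (\<exists>e\<in>fst X - snd X. \<exists>f\<in>snd X - fst X.
       Y = (insert f (fst X - {e}), insert e (snd X) - {f}))"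

text \<open>
  \<open>strictly_monotone_seq I A B t P\<close>: the pairs \<open>P 0, \<dots>, P t\<close> form a strictly monotone sequence
  of \<open>t\<close> symmetric exchanges for \<open>A\<close> and \<open>B\<close>; the values of \<open>P\<close> beyond \<open>t\<close> are irrelevant,
  and \<open>P t = B\<close> is not required.
\<close>

definition strictly_monotone_seq ::
  "'a set set \<Rightarrow> 'a set \<times> 'a set \<Rightarrow> 'a set \<times> 'a set \<Rightarrow> nat \<Rightarrow> (nat \<Rightarrow> 'a set \<times> 'a set) \<Rightarrow> bool" where
  "strictly_monotone_seq I A B t P \<longleftrightarrow>
    P 0 = A \<and>
    (\<forall>i<t. symmetric_exchange I (P i) (P (Suc i)) \<and>
       card (fst (P (Suc i)) - fst B) < card (fst (P i) - fst B))"

end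

theory Submission
  imports Defs
begin

text \<open>
  Compatibility is preserved by symmetric exchanges, and for a current pair \<open>(X1, X2)\<close> it gives
  \<open>X1 - B1 = B2 - X2\<close> and \<open>X2 - B2 = B1 - X1\<close>. Call these sets \<open>P\<close> and \<open>Q\<close>; they have the same size
  \<open>d\<close>, which at the start is \<open>r - |A1 \<inter> B1|\<close>. A strictly decreasing step is an exchange of some
  \<open>e \<in> P\<close> with some \<open>f \<in> Q\<close>, and it lowers \<open>d\<close> by exactly one. So the length of a sequence is the
  drop in \<open>d\<close>, and the three bounds ask for bringing \<open>d\<close> down far enough.

  In a paving matroid each \<open>f \<in> Q\<close> fails to replace at most one element of \<open>X1\<close>, and each \<open>e \<in> P\<close>
  fails to replace at most one element of \<open>X2\<close>. Hence some pair is exchangeable as long as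
  \<open>d \<ge> 3\<close>, and the greedy procedure reaches \<open>d \<le> 2\<close> (\<open>paving_descent\<close>).

  A split matroid is a direct sum of uniform matroids and one elementary split matroid on a set
  \<open>N\<close>. Exchanges inside the uniform summands are always possible, so they are done first and
  thereafter \<open>P\<close> and \<open>Q\<close> lie in \<open>N\<close>. There a replacement is obstructed only by tight constraints
  \<open>|X \<inter> H i| = rs i\<close>. The intersection bound on the \<open>H i\<close> makes tight constraints rigid: if distinct \<open>i\<close> and
  \<open>j\<close> are both tight for a base \<open>X\<close>, then \<open>H i \<inter> H j \<subseteq> X\<close> and \<open>X \<inter> N \<subseteq> H i \<union> H j\<close>. So an element
  outside \<open>X\<close> lies in at most one tight set and an element of \<open>X \<inter> N\<close> avoids at most one.

  The central notion is a locked pair: \<open>X1\<close> and \<open>B1\<close> are both tight for some \<open>i, j\<close>, \<open>X2\<close> and \<open>B2\<close>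
  are both tight for some \<open>k, l\<close>, and every element of \<open>P \<union> Q\<close> has a type, that is, lies in exactly
  one of \<open>H i, H j\<close> and exactly one of \<open>H k, H l\<close>, with two prescribed types occurring in \<open>P\<close> and
  the other two in \<open>Q\<close>. The dichotomy \<open>descent_or_locked\<close> says that a pair with \<open>P \<subseteq> N\<close> is
  locked or can be moved all the way to \<open>d = 0\<close>. It rests on two facts. A pair without any
  admissible exchange is locked (\<open>stuck_locked\<close>). And if an exchange leads from a pair that is not
  locked to a locked one, then putting another element in place of one of the two exchanged
  elements gives an admissible exchange whose result is not locked (\<open>alternative_not_locked\<close>); thus being
  unlocked can be preserved until \<open>d = 0\<close>.

  It remains to see that locked pairs have small \<open>d\<close>. The typed elements of \<open>P \<union> Q\<close> fit into the
  four sets \<open>H i \<inter> H k\<close>, \<open>H i \<inter> H l\<close>, \<open>H j \<inter> H k\<close>, \<open>H j \<inter> H l\<close>, and the bounds on these give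
  \<open>d \<le> 2 |X1 \<inter> B1 \<inter> N|\<close> (\<open>locked_bound\<close>), hence the
  bound for split matroids. If the matroid is base orderable, the
  exchange bijection from \<open>X1\<close> to \<open>X2\<close> maps all but at most \<open>|X1 \<inter> B1 \<inter> N|\<close> elements of \<open>P\<close> into \<open>Q\<close>,
  each to an element of its own type. Exchanges between elements of the same type do not affect
  tightness, so all of these can be carried out one after another (\<open>base_orderable_descent\<close>), hence
  the bound for base orderable split matroids.
\<close>

section \<open>Bases and descents\<close>

lemma card_exchange:
  assumes "finite X" "e \<in> X" "f \<notin> X"
  shows "card (insert f (X - {e}) \<inter> K) + of_bool (e \<in> K) = card (X \<inter> K) + of_bool (f \<in> K)"
proof -
  have 1: "card ((X - {e}) \<inter> K) + of_bool (e \<in> K) = card (X \<inter> K)"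
  proof (cases "e \<in> K")
    case True
    then have "X \<inter> K = insert e ((X - {e}) \<inter> K)" using assms by blast
    then have "card (X \<inter> K) = Suc (card ((X - {e}) \<inter> K))" using assms(1) by simp
    then show ?thesis using True by simp
  next
    case False
    then have "(X - {e}) \<inter> K = X \<inter> K" by blast
    then show ?thesis using False by simp
  qed
  have 2: "card (insert f (X - {e}) \<inter> K) = card ((X - {e}) \<inter> K) + of_bool (f \<in> K)"
    using assms by (simp add: Int_insert_left)
  show ?thesis using 1 2 by simp
qed

lemma card_eq_sum_of_cover:
  assumes "finite W" "\<And>x. x \<in> W \<Longrightarrow> x \<in> A \<longleftrightarrow> x \<notin> B"
  shows "card W = card (W \<inter> A) + card (W \<inter> B)"
proof -
  have "W = (W \<inter> A) \<union> (W \<inter> B)" "(W \<inter> A) \<inter> (W \<inter> B) = {}" using assms(2) by blast+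
  then show ?thesis using card_Un_disjoint[of "W \<inter> A" "W \<inter> B"] assms(1) by simp
qed

lemma card_Int_balance:
  fixes X :: "'b set"
  assumes "finite X" "finite B"
  shows "card (X \<inter> K) + card ((B - X) \<inter> K) = card (B \<inter> K) + card ((X - B) \<inter> K)"
proof -
  have "card (X \<inter> K) = card (X \<inter> B \<inter> K) + card ((X - B) \<inter> K)"
    if "finite X" for X B :: "'b set"
  proof -
    have "X \<inter> K = (X \<inter> B \<inter> K) \<union> ((X - B) \<inter> K)" by blast
    moreover have "card ((X \<inter> B \<inter> K) \<union> ((X - B) \<inter> K)) = card (X \<inter> B \<inter> K) + card ((X - B) \<inter> K)"
      using that by (intro card_Un_disjoint) auto
    ultimately show ?thesis by simp
  qed
  from this[OF assms(1), of B] this[OF assms(2), of X] show ?thesis by (simp add: Int_commute)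
qed

context matroid
begin

lemma finite_indep: "X \<in> I \<Longrightarrow> finite X"
  using finite_ground indep_subset_ground finite_subset by blast

lemma finite_family: "finite I"
proof -
  have "I \<subseteq> Pow S" using indep_subset_ground by blast
  then show ?thesis using finite_ground finite_subset by blast
qed

lemma card_indep_le: "X \<in> I \<Longrightarrow> card X \<le> mrank I"
  unfolding mrank_def using finite_family by simp

lemma base_indep: "B \<in> bases I \<Longrightarrow> B \<in> I"
  by (simp add: bases_def)

lemma finite_base: "B \<in> bases I \<Longrightarrow> finite B"
  using base_indep finite_indep by blast

lemma card_base: assumes "B \<in> bases I" shows "card B = mrank I"
proof (rule ccontr)
  assume ne: "card B \<noteq> mrank I"
  have "mrank I \<in> card ` I" unfolding mrank_def using finite_family indep_empty by (intro Max_in) auto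
  then obtain X where X: "X \<in> I" "card X = mrank I" by auto
  have "card B < card X" using ne X card_indep_le[OF base_indep[OF assms]] by simp
  then obtain y where y: "y \<in> X - B" "insert y B \<in> I"
    using augmentation[OF base_indep[OF assms] X(1)] by blast
  then show False using assms unfolding bases_def by blast
qed

lemma baseI: assumes "B \<in> I" "card B = mrank I" shows "B \<in> bases I"
  unfolding bases_def
proof (intro CollectI conjI ballI impI)
  show "B \<in> I" by fact
  fix X assume "X \<in> I" "B \<subseteq> X"
  then show "X = B" using assms(2) card_indep_le[of X] card_seteq[of X B] finite_indep by simp
qed

lemma card_Diff_base:
  assumes "A \<in> bases I" "B \<in> bases I"
  shows "card (A - B) + card (A \<inter> B) = mrank I"
  using assms
  by (metis Int_Diff_disjoint Int_Diff_Un card_Un_disjoint card_base add.commute finite_Diff finite_Int finite_base)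

end

text \<open>
  Curried, so that exchanging the roles of the two members of both pairs is a plain permutation of
  arguments, and lemmas about one member apply to the other.
\<close>

definition compatible_bases :: "'a set set \<Rightarrow> 'a set \<Rightarrow> 'a set \<Rightarrow> 'a set \<Rightarrow> 'a set \<Rightarrow> bool" where
  "compatible_bases I X1 X2 B1 B2 \<longleftrightarrow>
    X1 \<in> bases I \<and> X2 \<in> bases I \<and> B1 \<in> bases I \<and> B2 \<in> bases I \<and>
    X1 \<inter> X2 = B1 \<inter> B2 \<and> X1 \<union> X2 = B1 \<union> B2"

lemma compatible_bases_swap:
  "compatible_bases I X1 X2 B1 B2 \<Longrightarrow> compatible_bases I X2 X1 B2 B1"
  unfolding compatible_bases_def by blast

lemma compatible_bases_Diff:
  assumes "compatible_bases I X1 X2 B1 B2"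
  shows "X1 - B1 = B2 - X2" "X2 - B2 = B1 - X1"
  using assms unfolding compatible_bases_def by blast+

text \<open>
  Strictly monotone sequences that remember their end point, so that they can be extended at the
  front in inductions and concatenated.
\<close>

inductive descent ::
  "'a set set \<Rightarrow> 'a set \<Rightarrow> nat \<Rightarrow> 'a set \<times> 'a set \<Rightarrow> 'a set \<times> 'a set \<Rightarrow> bool"
  for I B where
  descent_refl: "descent I B 0 X X"
| descent_step: "symmetric_exchange I X Y \<Longrightarrow> card (fst Y - B) < card (fst X - B) \<Longrightarrow>
    descent I B n Y Z \<Longrightarrow> descent I B (Suc n) X Z"

lemma descent_trans:
  "descent I B m X Y \<Longrightarrow> descent I B n Y Z \<Longrightarrow> descent I B (m + n) X Z"
  by (induction rule: descent.induct) (auto intro: descent_step)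

lemma strictly_monotone_seq_of_descent:
  "descent I (fst B) n X Z \<Longrightarrow> \<exists>P. strictly_monotone_seq I X B n P"
proof (induction rule: descent.induct)
  case (descent_refl X)
  then show ?case by (auto simp: strictly_monotone_seq_def)
next
  case (descent_step X Y n Z)
  then obtain P where P: "strictly_monotone_seq I Y B n P" by blast
  have "strictly_monotone_seq I X B (Suc n) (case_nat X P)"
    unfolding strictly_monotone_seq_def
  proof (intro conjI allI impI)
    fix i assume "i < Suc n"
    then show "symmetric_exchange I (case_nat X P i) (case_nat X P (Suc i))"
      and "card (fst (case_nat X P (Suc i)) - fst B) < card (fst (case_nat X P i) - fst B)"
      using P descent_step unfolding strictly_monotone_seq_def by (auto split: nat.split)
  qed simp
  then show ?case by blast
qed

text \<open>
  Everything that an induction along a descent has to know about one step. An exchange is entered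
  through an element of \<open>X1 - B1\<close> and one of \<open>X2 - B2\<close>, so the step decreases the difference
  automatically.
\<close>

lemma (in matroid) exchange_step:
  assumes comp: "compatible_bases I X1 X2 B1 B2"
    and e: "e \<in> X1 - B1" and f: "f \<in> X2 - B2"
    and Y1: "insert f (X1 - {e}) \<in> bases I" and Y2: "insert e (X2 - {f}) \<in> bases I"
  defines "Y \<equiv> (insert f (X1 - {e}), insert e (X2 - {f}))"
  shows "compatible_bases I (fst Y) (snd Y) B1 B2"
    and "fst Y - B1 = X1 - B1 - {e}" and "snd Y - B2 = X2 - B2 - {f}"
    and "card (X1 - B1) = Suc (card (fst Y - B1))"
    and "descent I B1 n Y Z \<Longrightarrow> descent I B1 (Suc n) (X1, X2) Z"
proof -
  have ef: "e \<notin> X2" "f \<notin> X1" "e \<in> B2" "f \<in> B1" "e \<noteq> f"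
    using comp e f unfolding compatible_bases_def by blast+
  show "compatible_bases I (fst Y) (snd Y) B1 B2"
    using comp ef e f Y1 Y2 unfolding compatible_bases_def Y_def by auto
  show P: "fst Y - B1 = X1 - B1 - {e}" and "snd Y - B2 = X2 - B2 - {f}"
    using ef unfolding Y_def by auto
  have "finite (X1 - B1)" using comp finite_base unfolding compatible_bases_def by blast
  then show less: "card (X1 - B1) = Suc (card (fst Y - B1))"
    unfolding P using card_Suc_Diff1 e by metis
  have "Y = (insert f (X1 - {e}), insert e X2 - {f})" using ef unfolding Y_def by auto
  then have "symmetric_exchange I (X1, X2) Y"
    using comp ef e f Y1 Y2 unfolding symmetric_exchange_def compatible_bases_def Y_def by auto
  then show "descent I B1 n Y Z \<Longrightarrow> descent I B1 (Suc n) (X1, X2) Z"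
    using less by (intro descent_step) auto
qed

section \<open>Paving matroids\<close>

text \<open>
  The set \<open>X - {e, e'} + f\<close> has fewer elements than the rank and is therefore independent. It can be
  augmented from \<open>X\<close>, and only by \<open>e\<close> or \<open>e'\<close>.
\<close>

lemma (in matroid) paving_exchange:
  assumes "paving S I" "X \<in> bases I" "e \<in> X" "e' \<in> X" "e \<noteq> e'" "f \<notin> X" "f \<in> S"
  shows "insert f (X - {e}) \<in> bases I \<or> insert f (X - {e'}) \<in> bases I"
proof -
  define W where "W = insert f (X - {e, e'})"
  have fin: "finite X" using assms finite_base by blast
  have "card (X - {e, e'}) = card X - 2"
    using assms fin by (subst card_Diff_subset) auto
  moreover have "card {e, e'} \<le> card X" using assms fin by (intro card_mono) auto
  ultimately have cW: "Suc (card W) = card X" using assms fin unfolding W_def by simp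
  have "W \<subseteq> S" using assms base_indep indep_subset_ground unfolding W_def by blast
  then have "W \<in> I" using assms(1) cW card_base[OF assms(2)] unfolding paving_def by auto
  then obtain y where y: "y \<in> X - W" "insert y W \<in> I"
    using augmentation[of W X] cW base_indep[OF assms(2)] by auto
  have "card (insert y W) = mrank I"
    using y fin cW card_base[OF assms(2)] unfolding W_def by simp
  then have b: "insert y W \<in> bases I" using y baseI by blast
  have "y = e \<or> y = e'" using y unfolding W_def by blast
  moreover have "insert e W = insert f (X - {e'})" "insert e' W = insert f (X - {e})"
    using assms unfolding W_def by auto
  ultimately show ?thesis using b by auto
qed

lemma (in matroid) paving_descent:
  assumes "paving S I" "compatible_bases I X1 X2 B1 B2"
  shows "\<exists>n Y. descent I B1 n (X1, X2) Y \<and> card (X1 - B1) \<le> n + 2"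
  using assms(2)
proof (induction "card (X1 - B1)" arbitrary: X1 X2 rule: less_induct)
  case less
  note comp = less.prems
  have b: "X1 \<in> bases I" "X2 \<in> bases I" "B1 \<in> bases I" "B2 \<in> bases I"
    using comp unfolding compatible_bases_def by blast+
  show ?case
  proof (cases "card (X1 - B1) \<le> 2")
    case True
    then show ?thesis using descent_refl[of I B1] by fastforce
  next
    case False
    have "card (X1 - B1) = card (X2 - B2)"
      unfolding compatible_bases_Diff(2)[OF comp]
      using card_Diff_base[OF b(1,3)] card_Diff_base[OF b(3,1)] by (simp add: Int_commute)
    then have c: "3 \<le> card (X1 - B1)" "2 \<le> card (X2 - B2)" using False by auto
    \<comment> \<open>Three candidates \<open>e\<close> and two candidates \<open>f\<close> suffice: each of \<open>f1\<close>, \<open>f2\<close> can replace at least two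
      of the three elements, so they share one, and that one can replace \<open>f1\<close> or \<open>f2\<close>.\<close>
    obtain E where "E \<subseteq> X1 - B1" "card E = 3" using obtain_subset_with_card_n[OF c(1)] by metis
    then obtain e1 e2 e3 where e: "e1 \<in> X1 - B1" "e2 \<in> X1 - B1" "e3 \<in> X1 - B1"
      "e1 \<noteq> e2" "e1 \<noteq> e3" "e2 \<noteq> e3"
      by (auto simp: card_3_iff)
    obtain F where "F \<subseteq> X2 - B2" "card F = 2" using obtain_subset_with_card_n[OF c(2)] by metis
    then obtain f1 f2 where f: "f1 \<in> X2 - B2" "f2 \<in> X2 - B2" "f1 \<noteq> f2"
      by (auto simp: card_2_iff)
    have X: "X1 \<subseteq> S" "X2 \<subseteq> S" using b base_indep indep_subset_ground by blast+
    have dj: "x \<notin> X2" if "x \<in> X1 - B1" for x using that compatible_bases_Diff(1)[OF comp] by blast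
    have dj': "x \<notin> X1" if "x \<in> X2 - B2" for x using that compatible_bases_Diff(2)[OF comp] by blast
    have 1: "insert x (X1 - {y}) \<in> bases I \<or> insert x (X1 - {y'}) \<in> bases I"
      if "x \<in> X2 - B2" "y \<in> X1 - B1" "y' \<in> X1 - B1" "y \<noteq> y'" for x y y'
      using paving_exchange[OF assms(1) b(1), of y y' x] that X dj' by blast
    have 2: "insert y (X2 - {x}) \<in> bases I \<or> insert y (X2 - {x'}) \<in> bases I"
      if "y \<in> X1 - B1" "x \<in> X2 - B2" "x' \<in> X2 - B2" "x \<noteq> x'" for x x' y
      using paving_exchange[OF assms(1) b(2), of x x' y] that X dj by blast
    have "\<exists>e \<in> X1 - B1. \<exists>f \<in> X2 - B2. insert f (X1 - {e}) \<in> bases I \<and> insert e (X2 - {f}) \<in> bases I"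
      using 1[OF f(1) e(1,2,4)] 1[OF f(1) e(1,3,5)] 1[OF f(1) e(2,3,6)]
        1[OF f(2) e(1,2,4)] 1[OF f(2) e(1,3,5)] 1[OF f(2) e(2,3,6)]
        2[OF e(1) f] 2[OF e(2) f] 2[OF e(3) f] e(1-3) f(1,2) by meson
    then obtain x y where xy: "x \<in> X1 - B1" "y \<in> X2 - B2"
      "insert y (X1 - {x}) \<in> bases I" "insert x (X2 - {y}) \<in> bases I" by blast
    note st = exchange_step[OF comp xy]
    from less.hyps[OF _ st(1)] obtain n Y where
      Y: "descent I B1 n (insert y (X1 - {x}), insert x (X2 - {y})) Y"
      "card (insert y (X1 - {x}) - B1) \<le> n + 2"
      using st(4) by auto
    then show ?thesis using st(5)[OF Y(1)] st(4) by fastforce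
  qed
qed

section \<open>Presentations of split matroids\<close>

text \<open>
  A direct sum of uniform matroids on the sets \<open>C \<in> \<C>\<close> and one elementary split matroid on \<open>N\<close>, in
  terms of inequalities. The set \<open>N\<close> may be empty, which covers the split matroids all of whose
  components are uniform.
\<close>

locale split_presentation = matroid S I for S :: "'a set" and I +
  fixes N :: "'a set" and \<rho> :: nat and J :: "nat set" and H :: "nat \<Rightarrow> 'a set" and rs :: "nat \<Rightarrow> nat"
    and \<C> :: "'a set set" and cap :: "'a set \<Rightarrow> nat"
  assumes cover: "S = N \<union> \<Union> \<C>"
    and disjoint_N: "C \<in> \<C> \<Longrightarrow> C \<inter> N = {}"
    and disjoint_blocks: "C \<in> \<C> \<Longrightarrow> D \<in> \<C> \<Longrightarrow> C \<noteq> D \<Longrightarrow> C \<inter> D = {}"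
    and H_subset: "i \<in> J \<Longrightarrow> H i \<subseteq> N"
    and card_H_Int: "i \<in> J \<Longrightarrow> j \<in> J \<Longrightarrow> i \<noteq> j \<Longrightarrow> card (H i \<inter> H j) + \<rho> \<le> rs i + rs j"
    and rank_N: "\<rho> \<le> card N"
    and rank_H: "i \<in> J \<Longrightarrow> \<rho> \<le> card (N - H i) + rs i"
    and cap_le: "C \<in> \<C> \<Longrightarrow> cap C \<le> card C"
    and indep_iff: "X \<in> I \<longleftrightarrow> X \<subseteq> S \<and> card (X \<inter> N) \<le> \<rho> \<and> (\<forall>i\<in>J. card (X \<inter> H i) \<le> rs i) \<and>
      (\<forall>C\<in>\<C>. card (X \<inter> C) \<le> cap C)"
begin

lemma finite_N: "finite N"
  using cover finite_ground by simp

definition tight :: "'a set \<Rightarrow> nat \<Rightarrow> bool" where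
  "tight X i \<longleftrightarrow> i \<in> J \<and> card (X \<inter> H i) = rs i"

text \<open>
  Two tight constraints use up the whole rank: by inclusion and exclusion the bound on
  \<open>card (H i \<inter> H j)\<close> can only be met with equality throughout.
\<close>

lemma tight_pair_bound:
  assumes "X \<in> I" "tight X i" "tight X j" "i \<noteq> j"
  shows "card (X \<inter> N) = \<rho>" "X \<inter> N \<subseteq> H i \<union> H j" "H i \<inter> H j \<subseteq> X"
proof -
  have fin: "finite X" "finite (H i)" "finite (H j)"
    using assms finite_indep finite_subset[OF H_subset finite_N] unfolding tight_def by auto
  have sub: "H i \<subseteq> N" "H j \<subseteq> N" using assms H_subset unfolding tight_def by blast+
  have "card (X \<inter> H i) + card (X \<inter> H j) =
      card ((X \<inter> H i) \<union> (X \<inter> H j)) + card ((X \<inter> H i) \<inter> (X \<inter> H j))"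
    using fin by (intro card_Un_Int) auto
  then have 1: "rs i + rs j = card (X \<inter> (H i \<union> H j)) + card (X \<inter> (H i \<inter> H j))"
    using assms unfolding tight_def by (simp add: Int_Un_distrib Int_ac)
  have 2: "card (X \<inter> (H i \<union> H j)) \<le> card (X \<inter> N)" using fin sub by (intro card_mono) auto
  have 3: "card (X \<inter> (H i \<inter> H j)) \<le> card (H i \<inter> H j)" using fin by (intro card_mono) auto
  have 4: "card (H i \<inter> H j) + \<rho> \<le> rs i + rs j" using assms card_H_Int unfolding tight_def by blast
  have 5: "card (X \<inter> N) \<le> \<rho>" using assms(1) indep_iff by blast
  show "card (X \<inter> N) = \<rho>" using 1 2 3 4 5 by linarith
  have "X \<inter> (H i \<union> H j) = X \<inter> N" using 1 2 3 4 5 fin sub by (intro card_seteq) auto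
  then show "X \<inter> N \<subseteq> H i \<union> H j" by blast
  have "X \<inter> (H i \<inter> H j) = H i \<inter> H j" using 1 2 3 4 5 fin by (intro card_seteq) auto
  then show "H i \<inter> H j \<subseteq> X" by blast
qed

text \<open>
  An independent set that is too small in \<open>N\<close> has at most one tight constraint, because two of them
  force rank \<open>\<rho>\<close>; the condition \<open>rank_H\<close> leaves an element outside that one constraint.
\<close>

lemma card_base_N: assumes X: "X \<in> bases I" shows "card (X \<inter> N) = \<rho>"
proof (rule ccontr)
  assume ne: "card (X \<inter> N) \<noteq> \<rho>"
  have XI: "X \<in> I" using X base_indep by blast
  then have less: "card (X \<inter> N) < \<rho>" using ne indep_iff[of X] by linarith
  have fin: "finite X" using XI finite_indep by blast
  have "\<exists>y \<in> N - X. \<forall>i. tight X i \<longrightarrow> y \<notin> H i"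
  proof (cases "\<exists>i. tight X i")
    case False
    have "\<not> N \<subseteq> X"
    proof
      assume "N \<subseteq> X"
      then have "X \<inter> N = N" by blast
      then show False using less rank_N by simp
    qed
    then show ?thesis using False by blast
  next
    case True
    then obtain i where i: "tight X i" by blast
    have "\<not> N - H i \<subseteq> X"
    proof
      assume "N - H i \<subseteq> X"
      then have "card (N - H i) \<le> card (X \<inter> N - X \<inter> H i)"
        using fin by (intro card_mono) auto
      moreover have "X \<inter> H i \<subseteq> X \<inter> N" using i H_subset unfolding tight_def by blast
      then have "card (X \<inter> N - X \<inter> H i) + card (X \<inter> H i) = card (X \<inter> N)"
        using fin by (simp add: card_Diff_subset card_mono)
      ultimately show False using i less rank_H[of i] unfolding tight_def by linarith
    qed
    then obtain y where y: "y \<in> N - X" "y \<notin> H i" by blast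
    moreover have "j = i" if "tight X j" for j using tight_pair_bound(1)[OF XI i that] ne by blast
    ultimately show ?thesis by blast
  qed
  then obtain y where y: "y \<in> N" "y \<notin> X" "\<And>i. tight X i \<Longrightarrow> y \<notin> H i" by blast
  have "insert y X \<in> I"
  proof (subst indep_iff, intro conjI ballI)
    show "insert y X \<subseteq> S" using XI indep_iff[of X] y cover by blast
    show "card (insert y X \<inter> N) \<le> \<rho>" using less fin y by simp
    fix i assume i: "i \<in> J"
    have "card (X \<inter> H i) \<le> rs i" using XI indep_iff[of X] i by blast
    moreover have "y \<notin> H i" if "card (X \<inter> H i) = rs i" using y(3)[of i] i that unfolding tight_def by blast
    ultimately show "card (insert y X \<inter> H i) \<le> rs i" using fin y by (simp add: Int_insert_left) linarith
  next
    fix C assume C: "C \<in> \<C>"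
    then have "insert y X \<inter> C = X \<inter> C" using y disjoint_N by blast
    then show "card (insert y X \<inter> C) \<le> cap C" using XI indep_iff[of X] C by simp
  qed
  then show False using X y unfolding bases_def by blast
qed

lemma card_base_block: assumes X: "X \<in> bases I" and C: "C \<in> \<C>" shows "card (X \<inter> C) = cap C"
proof (rule ccontr)
  assume ne: "card (X \<inter> C) \<noteq> cap C"
  have XI: "X \<in> I" using X base_indep by blast
  then have less: "card (X \<inter> C) < cap C" using ne indep_iff[of X] C by fastforce
  have fin: "finite X" using XI finite_indep by blast
  have "\<not> C \<subseteq> X"
  proof
    assume "C \<subseteq> X"
    then have "X \<inter> C = C" by blast
    then show False using less cap_le[OF C] by simp
  qed
  then obtain y where y: "y \<in> C" "y \<notin> X" by blast
  have yN: "y \<notin> N" using y disjoint_N[OF C] by blast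
  have "insert y X \<in> I"
  proof (subst indep_iff, intro conjI ballI)
    show "insert y X \<subseteq> S" using XI indep_iff[of X] y C cover by blast
    show "card (insert y X \<inter> N) \<le> \<rho>" using XI indep_iff[of X] yN by simp
    fix i assume i: "i \<in> J"
    have "y \<notin> H i" using yN H_subset[OF i] by blast
    then show "card (insert y X \<inter> H i) \<le> rs i" using XI indep_iff[of X] i by simp
  next
    fix D assume D: "D \<in> \<C>"
    show "card (insert y X \<inter> D) \<le> cap D"
    proof (cases "D = C")
      case True
      then show ?thesis using less fin y by simp
    next
      case False
      then have "insert y X \<inter> D = X \<inter> D" using y disjoint_blocks[OF C D] by blast
      then show ?thesis using XI indep_iff[of X] D by simp
    qed
  qed
  then show False using X y unfolding bases_def by blast
qed

lemma exchange_block: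
  assumes X: "X \<in> bases I" and "e \<in> X" "f \<notin> X" and C: "C \<in> \<C>" "e \<in> C" "f \<in> C"
  shows "insert f (X - {e}) \<in> bases I"
proof (rule baseI)
  have XI: "X \<in> I" and fin: "finite X" using X base_indep finite_base by blast+
  note ce = card_exchange[OF fin assms(2,3)]
  have D: "e \<in> D \<longleftrightarrow> f \<in> D" if "D \<in> \<C>" for D using that C disjoint_blocks[OF C(1) that] by blast
  have "e \<notin> N" "f \<notin> N" using disjoint_N C by blast+
  then have N: "\<And>i. i \<in> J \<Longrightarrow> e \<notin> H i \<and> f \<notin> H i" "e \<notin> N \<and> f \<notin> N" using H_subset by blast+
  show "insert f (X - {e}) \<in> I"
  proof (subst indep_iff, intro conjI ballI)
    show "insert f (X - {e}) \<subseteq> S" using XI indep_iff[of X] C cover by blast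
    show "card (insert f (X - {e}) \<inter> N) \<le> \<rho>" using XI indep_iff[of X] ce[of N] N by simp
    show "card (insert f (X - {e}) \<inter> H i) \<le> rs i" if "i \<in> J" for i
      using XI indep_iff[of X] ce[of "H i"] N(1)[OF that] that by simp
    show "card (insert f (X - {e}) \<inter> D) \<le> cap D" if "D \<in> \<C>" for D
      using XI indep_iff[of X] ce[of D] D[OF that] that by simp
  qed
  show "card (insert f (X - {e})) = mrank I"
    using ce[of UNIV] card_base[OF X] by simp
qed

lemma exchange_N:
  assumes X: "X \<in> bases I" and "e \<in> X" "f \<notin> X" "e \<in> N" "f \<in> N"
    and t: "\<And>m. tight X m \<Longrightarrow> f \<in> H m \<Longrightarrow> e \<in> H m"
  shows "insert f (X - {e}) \<in> bases I"
proof (rule baseI)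
  have XI: "X \<in> I" and fin: "finite X" using X base_indep finite_base by blast+
  note ce = card_exchange[OF fin assms(2,3)]
  show "insert f (X - {e}) \<in> I"
  proof (subst indep_iff, intro conjI ballI)
    show "insert f (X - {e}) \<subseteq> S" using XI indep_iff[of X] assms cover by blast
    show "card (insert f (X - {e}) \<inter> N) \<le> \<rho>" using XI indep_iff[of X] ce[of N] assms by simp
    fix i assume i: "i \<in> J"
    have le: "card (X \<inter> H i) \<le> rs i" using XI indep_iff[of X] i by blast
    show "card (insert f (X - {e}) \<inter> H i) \<le> rs i"
    proof (cases "f \<in> H i \<and> e \<notin> H i")
      case True
      then have "card (X \<inter> H i) \<noteq> rs i" using t[of i] i unfolding tight_def by blast
      then show ?thesis using le ce[of "H i"] True by simp
    next
      case False
      then show ?thesis using le ce[of "H i"] by (cases "e \<in> H i"; cases "f \<in> H i") auto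
    qed
  next
    fix C assume C: "C \<in> \<C>"
    then have "insert f (X - {e}) \<inter> C = X \<inter> C" using assms disjoint_N by blast
    then show "card (insert f (X - {e}) \<inter> C) \<le> cap C" using XI indep_iff[of X] C by simp
  qed
  show "card (insert f (X - {e})) = mrank I"
    using ce[of UNIV] card_base[OF X] by simp
qed

lemma card_base_H: "X \<in> bases I \<Longrightarrow> i \<in> J \<Longrightarrow> card (X \<inter> H i) \<le> rs i"
  using base_indep indep_iff by blast

lemma tight_exchange:
  assumes X: "X \<in> bases I" and Y: "insert f (X - {e}) \<in> bases I" and "e \<in> X" "f \<notin> X"
    and t: "tight X m" and "f \<in> H m"
  shows "e \<in> H m"
proof (rule ccontr)
  assume "e \<notin> H m"
  then have "card (insert f (X - {e}) \<inter> H m) = Suc (card (X \<inter> H m))"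
    using card_exchange[OF finite_base[OF X] assms(3,4), of "H m"] assms(6) by simp
  then show False using card_base_H[OF Y, of m] t unfolding tight_def by simp
qed

lemma tight_exchange_same:
  assumes "X \<in> bases I" "e \<in> X" "f \<notin> X" "e \<in> H m \<longleftrightarrow> f \<in> H m"
  shows "tight (insert f (X - {e})) m \<longleftrightarrow> tight X m"
  using card_exchange[OF finite_base[OF assms(1)] assms(2,3), of "H m"] assms(4)
  unfolding tight_def by (cases "f \<in> H m") auto

lemma tight_unique:
  assumes "X \<in> bases I" "tight X i" "tight X j" "x \<notin> X" "x \<in> H i" "x \<in> H j"
  shows "i = j"
  using tight_pair_bound(3)[OF base_indep[OF assms(1)] assms(2,3)] assms(4-) by blast

lemma tight_miss_unique:
  assumes "X \<in> bases I" "tight X i" "tight X j" "x \<in> X" "x \<in> N" "x \<notin> H i" "x \<notin> H j"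
  shows "i = j"
  using tight_pair_bound(2)[OF base_indep[OF assms(1)] assms(2,3)] assms(4-) by blast

section \<open>Locked pairs\<close>

text \<open>
  In an aligned pair a replacement in \<open>X1\<close> cannot bring in an element of \<open>H i\<close> for one outside
  \<open>H i\<close>, and a replacement in \<open>X2\<close> cannot do so for \<open>H k\<close>. As \<open>H i, H j\<close> and \<open>H k, H l\<close> both split the
  elements still to be exchanged, only elements of the same type can be exchanged.
\<close>

definition separate :: "nat \<Rightarrow> nat \<Rightarrow> 'a set \<Rightarrow> bool" where
  "separate i j D \<longleftrightarrow> (\<forall>x \<in> D. x \<in> H i \<longleftrightarrow> x \<notin> H j)"

lemma separate_commute: "separate i j D \<longleftrightarrow> separate j i D"
  unfolding separate_def by blast

definition aligned where
  "aligned X1 X2 B1 B2 i j k l \<longleftrightarrow>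
    tight X1 i \<and> tight X1 j \<and> tight B1 i \<and> tight B1 j \<and>
    tight X2 k \<and> tight X2 l \<and> tight B2 k \<and> tight B2 l \<and>
    separate i j ((X1 - B1) \<union> (X2 - B2)) \<and> separate k l ((X1 - B1) \<union> (X2 - B2))"

text \<open>
  The four witnesses are of the types that occur in a pair without admissible exchanges, and they
  survive when exchanges between elements of equal type are undone. They identify the indices: as
  the tightness of \<open>B1\<close> and \<open>B2\<close> is independent of the current pair, they determine \<open>{i, j}\<close> and
  \<open>{k, l}\<close>, which is what \<open>alternative_not_locked\<close> exploits.
\<close>

definition locked where
  "locked X1 X2 B1 B2 i j k l \<longleftrightarrow> aligned X1 X2 B1 B2 i j k l \<and>
    (\<exists>x \<in> X1 - B1. x \<in> H j \<inter> H k) \<and> (\<exists>x \<in> X1 - B1. x \<in> H i \<inter> H l) \<and>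
    (\<exists>x \<in> X2 - B2. x \<in> H i \<inter> H k) \<and> (\<exists>x \<in> X2 - B2. x \<in> H j \<inter> H l)"

lemma locked_swap: "locked X1 X2 B1 B2 i j k l \<Longrightarrow> locked X2 X1 B2 B1 k l j i"
  unfolding locked_def aligned_def separate_commute[of i j] Un_commute[of "X1 - B1"]
    Int_commute[of "H j"] Int_commute[of "H i"]
  by (elim conjE, intro conjI) assumption+

lemma locked_relabel: "locked X1 X2 B1 B2 i j k l \<Longrightarrow> locked X1 X2 B1 B2 j i l k"
  unfolding locked_def aligned_def separate_commute[of i j] separate_commute[of k l]
  by (elim conjE, intro conjI) assumption+

lemma Diff_subset_N:
  assumes "compatible_bases I X1 X2 B1 B2" "X1 - B1 \<subseteq> N"
  shows "X2 - B2 \<subseteq> N" "card (X2 - B2) = card (X1 - B1)"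
proof -
  have b: "X1 \<in> bases I" "B1 \<in> bases I" using assms unfolding compatible_bases_def by blast+
  note fin = b[THEN finite_base]
  have "card (X1 \<inter> N) + card (X1 - N) = card (B1 \<inter> N) + card (B1 - N)"
    using b card_base card_Diff_subset_Int[of X1 N] card_Diff_subset_Int[of B1 N] fin
    by (metis Int_Diff_Un Int_Diff_disjoint card_Un_disjoint finite_Diff finite_Int)
  then have "card (X1 - N) = card (B1 - N)" using b card_base_N by simp
  moreover have "X1 - N \<subseteq> B1 - N" using assms by blast
  ultimately have "X1 - N = B1 - N" using fin by (intro card_seteq) auto
  then show "X2 - B2 \<subseteq> N" using compatible_bases_Diff(2)[OF assms(1)] by blast
  show "card (X2 - B2) = card (X1 - B1)"
    unfolding compatible_bases_Diff(2)[OF assms(1)]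
    using card_Diff_base[OF b] card_Diff_base[OF b(2,1)] by (simp add: Int_commute)
qed

text \<open>
  In the application \<open>(Y1, Y2)\<close> is the locked result of an exchange that moved \<open>e\<close> from the first to
  the second member, and \<open>e\<close> has no type. Moving a suitable \<open>e'\<close> instead of \<open>e\<close> is also admissible, and then \<open>e\<close>
  is still to be exchanged. If the new pair were locked as well, its indices would be the old ones,
  since the surviving witnesses each lie in only one tight set of \<open>B1\<close> or \<open>B2\<close> or avoid only one.
  But then \<open>e\<close> would have a type.
\<close>

lemma alternative_not_locked:
  assumes comp: "compatible_bases I Y1 Y2 B1 B2" and PN: "Y1 - B1 \<subseteq> N"
    and lk: "locked Y1 Y2 B1 B2 i j k l"
    and e: "e \<in> Y2" "e \<in> B2" "e \<notin> Y1" "e \<in> N"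
    and mixed: "\<not> ((e \<in> H i \<longleftrightarrow> e \<notin> H j) \<and> (e \<in> H k \<longleftrightarrow> e \<notin> H l))"
  shows "\<exists>e' \<in> Y1 - B1. insert e (Y1 - {e'}) \<in> bases I \<and> insert e' (Y2 - {e}) \<in> bases I \<and>
    (\<forall>i' j' k' l'. \<not> locked (insert e (Y1 - {e'})) (insert e' (Y2 - {e})) B1 B2 i' j' k' l')"
proof -
  have b: "Y1 \<in> bases I" "Y2 \<in> bases I" "B1 \<in> bases I" "B2 \<in> bases I"
    using comp unfolding compatible_bases_def by blast+
  note QN = Diff_subset_N(1)[OF comp PN]
  \<comment> \<open>Up to relabelling, \<open>e\<close> avoids \<open>H i\<close> and lies in \<open>H k\<close>; its lack of a type then means that it
    avoids \<open>H j\<close> too or lies in \<open>H l\<close> too.\<close>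
  have main: ?thesis
    if lk: "locked Y1 Y2 B1 B2 i j k l"
      and sub: "e \<notin> H i" "e \<in> H k" and mixed: "e \<notin> H j \<or> e \<in> H l" for i j k l
  proof -
    from lk obtain p p' q q' where
      p: "p \<in> Y1 - B1" "p \<in> H j" "p \<in> H k" and p': "p' \<in> Y1 - B1" "p' \<in> H i" "p' \<in> H l" and
      q: "q \<in> Y2 - B2" "q \<in> H i" "q \<in> H k" and q': "q' \<in> Y2 - B2" "q' \<in> H j" "q' \<in> H l"
      unfolding locked_def by blast
    have al: "aligned Y1 Y2 B1 B2 i j k l" using lk unfolding locked_def by blast
    have t: "tight Y1 i" "tight Y1 j" "tight B1 i" "tight B1 j"
      "tight Y2 k" "tight Y2 l" "tight B2 k" "tight B2 l"
      using al unfolding aligned_def by auto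
    have s: "(x \<in> H i \<longleftrightarrow> x \<notin> H j) \<and> (x \<in> H k \<longleftrightarrow> x \<notin> H l)" if "x \<in> Y1 - B1 \<or> x \<in> Y2 - B2" for x
      using al that unfolding aligned_def separate_def by blast
    have np: "x \<notin> Y2" "x \<in> Y1" "x \<in> N" "x \<noteq> e" if "x \<in> Y1 - B1" for x
      using that compatible_bases_Diff(1)[OF comp] PN e by blast+
    have eB1: "e \<notin> B1" using e comp unfolding compatible_bases_def by blast
    \<comment> \<open>The witness \<open>p\<close> takes the place of \<open>e\<close>: it avoids \<open>H i\<close> and lies in \<open>H k\<close>, as \<open>e\<close> does.\<close>
    have Y1': "insert e (Y1 - {p}) \<in> bases I"
    proof (rule exchange_N[OF b(1) np(2)[OF p(1)] e(3) np(3)[OF p(1)] e(4)])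
      fix m assume m: "tight Y1 m" "e \<in> H m"
      show "p \<in> H m"
        using tight_miss_unique[OF b(1) t(1) m(1) np(2,3)[OF p(1)]] s[of p] p sub m by blast
    qed
    have Y2': "insert p (Y2 - {e}) \<in> bases I"
    proof (rule exchange_N[OF b(2) e(1) np(1)[OF p(1)] e(4) np(3)[OF p(1)]])
      fix m assume m: "tight Y2 m" "p \<in> H m"
      show "e \<in> H m"
        using tight_unique[OF b(2) t(5) m(1) np(1)[OF p(1)] p(3) m(2)] sub by blast
    qed
    have "\<not> locked (insert e (Y1 - {p})) (insert p (Y2 - {e})) B1 B2 i' j' k' l'" for i' j' k' l'
    proof
      assume "locked (insert e (Y1 - {p})) (insert p (Y2 - {e})) B1 B2 i' j' k' l'"
      then have al': "aligned (insert e (Y1 - {p})) (insert p (Y2 - {e})) B1 B2 i' j' k' l'"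
        unfolding locked_def by blast
      then have t': "tight B1 i'" "tight B1 j'" "tight B2 k'" "tight B2 l'"
        unfolding aligned_def by auto
      have "p' \<noteq> p" using s[of p] p p' by blast
      moreover have "p \<in> B2" using p compatible_bases_Diff(1)[OF comp] by blast
      ultimately have s': "(x \<in> H i' \<longleftrightarrow> x \<notin> H j') \<and> (x \<in> H k' \<longleftrightarrow> x \<notin> H l')"
        if "x \<in> {e, p', q, q'}" for x
        using al' that p' q q' eB1 e(2) unfolding aligned_def separate_def by blast
      have B: "p' \<notin> B1" "q \<in> B1" "q' \<in> B1" "q \<notin> B2" "q' \<notin> B2" "q \<in> N" "q' \<in> N"
        using p' q q' compatible_bases_Diff(2)[OF comp] QN by blast+
      have ij: "i = i' \<or> i = j'"
        using s'[of p'] tight_unique[OF b(3) t(3) _ B(1) p'(2)] t' by blast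
      have "j = i' \<or> j = j'"
        using s'[of q] tight_miss_unique[OF b(3) t(4) _ B(2,6)] s[of q] q t' by blast
      then have 1: "e \<in> H i \<longleftrightarrow> e \<notin> H j" using ij s'[of e] s[of q] q by auto
      have kl: "k = k' \<or> k = l'"
        using s'[of q] tight_unique[OF b(4) t(7) _ B(4) q(3)] t' by blast
      have "l = k' \<or> l = l'"
        using s'[of q'] tight_unique[OF b(4) t(8) _ B(5) q'(3)] t' by blast
      then have 2: "e \<in> H k \<longleftrightarrow> e \<notin> H l" using kl s'[of e] s[of q] q by auto
      show False using 1 2 sub mixed by blast
    qed
    then show ?thesis using p Y1' Y2' by blast
  qed
  have al: "aligned Y1 Y2 B1 B2 i j k l" using lk unfolding locked_def by blast
  obtain p where p: "p \<in> Y1 - B1" "p \<in> H j" "p \<in> H k" using lk unfolding locked_def by blast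
  have ne: "i \<noteq> j" "k \<noteq> l" using al p unfolding aligned_def separate_def by blast+
  have "e \<in> H k \<or> e \<in> H l"
    using tight_pair_bound(2)[OF base_indep[OF b(2)], of k l] al ne e unfolding aligned_def separate_def by blast
  moreover have "e \<notin> H i \<or> e \<notin> H j"
    using tight_pair_bound(3)[OF base_indep[OF b(1)], of i j] al ne e unfolding aligned_def separate_def by blast
  ultimately show ?thesis
    using main[OF lk] main[OF locked_relabel[OF lk]] mixed by blast
qed

text \<open>
  The complementary case: exchanged elements that both have a type must have the same type, because
  the constraints are tight, and then undoing the exchange changes none of the relevant cardinalities.
\<close>

lemma locked_of_exchange:
  assumes comp: "compatible_bases I X1 X2 B1 B2"
    and e: "e \<in> X1 - B1" and f: "f \<in> X2 - B2"
    and Y: "insert f (X1 - {e}) \<in> bases I" "insert e (X2 - {f}) \<in> bases I"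
    and lk: "locked (insert f (X1 - {e})) (insert e (X2 - {f})) B1 B2 i j k l"
    and se: "separate i j {e}" "separate k l {e}" and sf: "separate i j {f}" "separate k l {f}"
  shows "locked X1 X2 B1 B2 i j k l"
proof -
  have b: "X1 \<in> bases I" "X2 \<in> bases I"
    using comp unfolding compatible_bases_def by blast+
  have ef: "e \<notin> X2" "f \<notin> X1" "e \<in> X1" "f \<in> X2" "e \<noteq> f" "f \<in> B1" "e \<in> B2"
    using e f compatible_bases_Diff[OF comp] by blast+
  let ?Y1 = "insert f (X1 - {e})" and ?Y2 = "insert e (X2 - {f})"
  have al: "aligned ?Y1 ?Y2 B1 B2 i j k l" using lk unfolding locked_def by blast
  have t: "tight ?Y1 i" "tight ?Y1 j" "tight B1 i" "tight B1 j"
      "tight ?Y2 k" "tight ?Y2 l" "tight B2 k" "tight B2 l"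
    using al unfolding aligned_def by auto
  have undo: "insert e (?Y1 - {f}) = X1" "insert f (?Y2 - {e}) = X2" using ef by auto
  have 1: "f \<in> H m" if "tight ?Y1 m" "e \<in> H m" for m
    using tight_exchange[OF Y(1), of e f m] undo b ef that by auto
  have 2: "e \<in> H m" if "tight ?Y2 m" "f \<in> H m" for m
    using tight_exchange[OF Y(2), of f e m] undo b ef that by auto
  have "e \<in> H i \<longleftrightarrow> f \<in> H i" "e \<in> H j \<longleftrightarrow> f \<in> H j"
    using 1[OF t(1)] 1[OF t(2)] se(1) sf(1) unfolding separate_def by auto
  then have t1: "tight X1 i" "tight X1 j"
    using t tight_exchange_same[OF b(1) ef(3,2)] by auto
  have "e \<in> H k \<longleftrightarrow> f \<in> H k" "e \<in> H l \<longleftrightarrow> f \<in> H l"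
    using 2[OF t(5)] 2[OF t(6)] se(2) sf(2) unfolding separate_def by auto
  then have t2: "tight X2 k" "tight X2 l"
    using t tight_exchange_same[OF b(2) ef(4,1)] by auto
  have P: "X1 - B1 = insert e (?Y1 - B1)" and Q: "X2 - B2 = insert f (?Y2 - B2)"
    using e f ef by auto
  have W: "(X1 - B1) \<union> (X2 - B2) = {e} \<union> ({f} \<union> ((?Y1 - B1) \<union> (?Y2 - B2)))"
    unfolding P Q by blast
  have sep_Un: "separate a b (C \<union> D) \<longleftrightarrow> separate a b C \<and> separate a b D" for a b C D
    unfolding separate_def by auto
  have "separate i j ((X1 - B1) \<union> (X2 - B2))" "separate k l ((X1 - B1) \<union> (X2 - B2))"
    unfolding W using al se sf unfolding aligned_def sep_Un by auto
  then have "aligned X1 X2 B1 B2 i j k l" using t t1 t2 unfolding aligned_def by auto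
  then show ?thesis using lk P Q unfolding locked_def by auto
qed

text \<open>No exchange of an \<open>e\<close> with an \<open>f\<close> is admissible, expressed through the tight sets that
  forbid the replacement in \<open>X1\<close> or in \<open>X2\<close>.\<close>

definition stuck where
  "stuck X1 X2 B1 B2 \<longleftrightarrow> (\<forall>e \<in> X1 - B1. \<forall>f \<in> X2 - B2.
    (\<exists>m. tight X1 m \<and> f \<in> H m \<and> e \<notin> H m) \<or> (\<exists>m. tight X2 m \<and> e \<in> H m \<and> f \<notin> H m))"

lemma stuck_swap: "stuck X1 X2 B1 B2 \<Longrightarrow> stuck X2 X1 B2 B1"
  unfolding stuck_def by blast

text \<open>Otherwise \<open>B1\<close> would violate the constraint \<open>m\<close>, which \<open>X1\<close> satisfies with equality.\<close>

lemma tight_card_le: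
  assumes comp: "compatible_bases I X1 X2 B1 B2" and t: "tight X1 m"
  shows "card ((X2 - B2) \<inter> H m) \<le> card ((X1 - B1) \<inter> H m)"
proof -
  have b: "X1 \<in> bases I" "B1 \<in> bases I" using comp unfolding compatible_bases_def by blast+
  show ?thesis
    using card_Int_balance[OF b[THEN finite_base], of "H m"] card_base_H[OF b(2), of m] t
    unfolding compatible_bases_Diff(2)[OF comp] tight_def by linarith
qed

text \<open>
  If no tight set of \<open>X1\<close> avoids \<open>e\<close>, then all replacements by \<open>e\<close> in \<open>X2\<close> are forbidden, and by
  the same tight set, as \<open>e\<close> lies in only one. That set contains \<open>e\<close> and nothing of \<open>X2 - B2\<close>, against
  \<open>tight_card_le\<close>. The second claim is dual.
\<close>

lemma stuck_tight:
  assumes comp: "compatible_bases I X1 X2 B1 B2" and PN: "X1 - B1 \<subseteq> N"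
    and st: "stuck X1 X2 B1 B2" and e: "e \<in> X1 - B1"
  shows "\<exists>m. tight X1 m \<and> e \<notin> H m" "\<exists>m. tight X2 m \<and> e \<in> H m"
proof -
  have b: "X1 \<in> bases I" "X2 \<in> bases I" using comp unfolding compatible_bases_def by blast+
  note fin = b[THEN finite_base]
  have eX: "e \<in> X1" "e \<notin> X2" "e \<in> N" using e compatible_bases_Diff(1)[OF comp] PN by blast+
  have cQ: "card (X2 - B2) = card (X1 - B1)" using Diff_subset_N(2)[OF comp PN] .
  have "X2 - B2 \<noteq> {}" using cQ e fin card_gt_0_iff[of "X1 - B1"] by fastforce
  then obtain f0 where f0: "f0 \<in> X2 - B2" by blast
  show "\<exists>m. tight X1 m \<and> e \<notin> H m"
  proof (rule ccontr)
    assume no: "\<not> ?thesis"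
    then have bad: "\<exists>m. tight X2 m \<and> e \<in> H m \<and> f \<notin> H m" if "f \<in> X2 - B2" for f
      using st e that unfolding stuck_def by blast
    obtain n where n: "tight X2 n" "e \<in> H n" using bad[OF f0] by blast
    have "f \<notin> H n" if "f \<in> X2 - B2" for f
      using bad[OF that] tight_unique[OF b(2) n(1) _ eX(2) n(2)] by blast
    then have "(X2 - B2) \<inter> H n = {}" by blast
    then have "card ((X1 - B1) \<inter> H n) = 0"
      using tight_card_le[OF compatible_bases_swap[OF comp] n(1)] by simp
    then show False using fin e n by auto
  qed
  show "\<exists>m. tight X2 m \<and> e \<in> H m"
  proof (rule ccontr)
    assume no: "\<not> ?thesis"
    then have bad: "\<exists>m. tight X1 m \<and> f \<in> H m \<and> e \<notin> H m" if "f \<in> X2 - B2" for f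
      using st e that unfolding stuck_def by blast
    obtain m where m: "tight X1 m" "e \<notin> H m" using bad[OF f0] by blast
    have "f \<in> H m" if "f \<in> X2 - B2" for f
      using bad[OF that] tight_miss_unique[OF b(1) m(1) _ eX(1,3) m(2)] by blast
    then have "(X2 - B2) \<inter> H m = X2 - B2" by blast
    then have "card (X1 - B1) \<le> card ((X1 - B1) \<inter> H m)"
      using tight_card_le[OF comp m(1)] cQ by simp
    then have "(X1 - B1) \<inter> H m = X1 - B1" using fin by (intro card_seteq) auto
    then show False using e m by blast
  qed
qed

text \<open>
  Each \<open>e\<close> in \<open>P\<close> avoids exactly one tight set \<open>m\<close> of \<open>X1\<close> and lies in exactly one tight set \<open>n\<close> of
  \<open>X2\<close>, and being stuck says \<open>Q \<inter> H n \<subseteq> H m\<close> for these. The forbidden pairs thus are covered by two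
  families of disjoint bicliques in \<open>P \<times> Q\<close>, one for each member, and the cardinality bounds
  \<open>tight_card_le\<close> leave only the pattern where each family consists of two bicliques crossing those
  of the other. These are the four types; adding up the bounds forces equality in all of
  them, which is the tightness of \<open>B1\<close> and \<open>B2\<close>.
\<close>

lemma stuck_locked:
  assumes comp: "compatible_bases I X1 X2 B1 B2" and PN: "X1 - B1 \<subseteq> N"
    and ne: "X1 - B1 \<noteq> {}" and st: "stuck X1 X2 B1 B2"
  shows "\<exists>i j k l. locked X1 X2 B1 B2 i j k l"
proof -
  define P Q where "P = X1 - B1" and "Q = X2 - B2"
  have b: "X1 \<in> bases I" "X2 \<in> bases I" "B1 \<in> bases I" "B2 \<in> bases I"
    using comp unfolding compatible_bases_def by blast+
  note comp' = compatible_bases_swap[OF comp]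
  note QN = Diff_subset_N(1)[OF comp PN]
  have fin: "finite P" "finite Q" using b finite_base unfolding P_def Q_def by blast+
  have cQ: "card Q = card P" using Diff_subset_N(2)[OF comp PN] unfolding P_def Q_def .
  have inP: "x \<in> X1" "x \<notin> X2" "x \<in> N" if "x \<in> P" for x
    using that PN compatible_bases_Diff(1)[OF comp] unfolding P_def by blast+
  have inQ: "x \<in> X2" "x \<notin> X1" "x \<in> N" if "x \<in> Q" for x
    using that QN compatible_bases_Diff(2)[OF comp] unfolding Q_def by blast+
  have tP: "\<exists>m. tight X1 m \<and> e \<notin> H m" "\<exists>m. tight X2 m \<and> e \<in> H m" if "e \<in> P" for e
    using stuck_tight[OF comp PN st] that unfolding P_def by blast+
  have tQ: "\<exists>m. tight X2 m \<and> f \<notin> H m" "\<exists>m. tight X1 m \<and> f \<in> H m" if "f \<in> Q" for f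
    using stuck_tight[OF comp' QN stuck_swap[OF st]] that unfolding Q_def by blast+
  have le1: "card (Q \<inter> H m) \<le> card (P \<inter> H m)" if "tight X1 m" for m
    using tight_card_le[OF comp that] unfolding P_def Q_def .
  have le2: "card (P \<inter> H m) \<le> card (Q \<inter> H m)" if "tight X2 m" for m
    using tight_card_le[OF comp' that] unfolding P_def Q_def .
  have nonempty: "D \<noteq> {}" if "card C \<le> card D" "x \<in> C" "finite C" for C D :: "'a set" and x
    using that by (metis card.empty card_0_eq empty_iff le_zero_eq)
  have key: "f \<in> H m \<or> f \<notin> H n"
    if "e \<in> P" "f \<in> Q" "tight X1 m" "e \<notin> H m" "tight X2 n" "e \<in> H n" for e f m n
  proof -
    have "(\<exists>m. tight X1 m \<and> f \<in> H m \<and> e \<notin> H m) \<or> (\<exists>m. tight X2 m \<and> e \<in> H m \<and> f \<notin> H m)"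
      using st[unfolded stuck_def, rule_format, of e f] that(1,2) unfolding P_def Q_def by simp
    then consider m' where "tight X1 m'" "f \<in> H m'" "e \<notin> H m'" | n' where "tight X2 n'" "e \<in> H n'" "f \<notin> H n'"
      by blast
    then show ?thesis
    proof cases
      case 1
      then show ?thesis using tight_miss_unique[OF b(1) that(3) 1(1) inP(1,3)[OF that(1)] that(4)] by blast
    next
      case 2
      then show ?thesis using tight_unique[OF b(2) that(5) 2(1) inP(2)[OF that(1)] that(6)] by blast
    qed
  qed
  obtain e0 where e0: "e0 \<in> P" using ne unfolding P_def by blast
  obtain i where i: "tight X1 i" "e0 \<notin> H i" using tP(1)[OF e0] by blast
  obtain k where k: "tight X2 k" "e0 \<in> H k" using tP(2)[OF e0] by blast
  obtain f0 where f0: "f0 \<in> Q" "f0 \<in> H k"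
    using nonempty[OF le2[OF k(1)], of e0] e0 k(2) fin by blast
  have f0i: "f0 \<in> H i" using key[OF e0 f0(1) i k] f0(2) by blast
  obtain l where l: "tight X2 l" "f0 \<notin> H l" using tQ(1)[OF f0(1)] by blast
  have "Q \<inter> H i \<noteq> Q"
  proof
    assume "Q \<inter> H i = Q"
    then have "card P \<le> card (P \<inter> H i)" using le1[OF i(1)] cQ by simp
    then have "P \<inter> H i = P" using fin by (intro card_seteq) auto
    then show False using e0 i(2) by blast
  qed
  then obtain f1 where f1: "f1 \<in> Q" "f1 \<notin> H i" by blast
  obtain j where j: "tight X1 j" "f1 \<in> H j" using tQ(2)[OF f1(1)] by blast
  have f1k: "f1 \<notin> H k" using key[OF e0 f1(1) i k] f1(2) by blast
  have ij: "i \<noteq> j" using f1 j by blast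
  have kl: "k \<noteq> l" using f0 l by blast
  have P_ij: "e \<in> H i \<or> e \<in> H j" if "e \<in> P" for e
    using tight_pair_bound(2)[OF base_indep[OF b(1)] i(1) j(1) ij] inP[OF that] by blast
  have P_kl: "e \<notin> H k \<or> e \<notin> H l" if "e \<in> P" for e
    using tight_pair_bound(3)[OF base_indep[OF b(2)] k(1) l(1) kl] inP[OF that] by blast
  have Q_ij: "f \<notin> H i \<or> f \<notin> H j" if "f \<in> Q" for f
    using tight_pair_bound(3)[OF base_indep[OF b(1)] i(1) j(1) ij] inQ[OF that] by blast
  have Q_kl: "f \<in> H k \<or> f \<in> H l" if "f \<in> Q" for f
    using tight_pair_bound(2)[OF base_indep[OF b(2)] k(1) l(1) kl] inQ[OF that] by blast
  have typeP: "e \<notin> H i \<and> e \<in> H k \<or> e \<notin> H j \<and> e \<in> H l" if e: "e \<in> P" for e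
  proof -
    obtain m where m: "tight X1 m" "e \<notin> H m" using tP(1)[OF e] by blast
    obtain n where n: "tight X2 n" "e \<in> H n" using tP(2)[OF e] by blast
    have n0: "f0 \<notin> H n \<Longrightarrow> n = l"
      using tight_miss_unique[OF b(2) n(1) l(1) inQ(1,3)[OF f0(1)]] l by blast
    have n1: "f1 \<notin> H n \<Longrightarrow> n = k"
      using tight_miss_unique[OF b(2) n(1) k(1) inQ(1,3)[OF f1(1)]] f1k by blast
    have m0: "f0 \<in> H m \<Longrightarrow> m = i"
      using tight_unique[OF b(1) m(1) i(1) inQ(2)[OF f0(1)]] f0i by blast
    have m1: "f1 \<in> H m \<Longrightarrow> m = j"
      using tight_unique[OF b(1) m(1) j(1) inQ(2)[OF f1(1)]] j by blast
    show ?thesis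
      using key[OF e f0(1) m n] key[OF e f1(1) m n] n0 n1 m0 m1 kl ij m n by metis
  qed
  obtain e1 where e1: "e1 \<in> P" "e1 \<in> H i"
    using nonempty[OF le1[OF i(1)], of f0] f0 f0i fin by blast
  have e1': "e1 \<notin> H j" "e1 \<in> H l" using typeP[OF e1(1)] e1(2) by blast+
  have sepP: "(e \<in> H i \<longleftrightarrow> e \<notin> H j) \<and> (e \<in> H k \<longleftrightarrow> e \<notin> H l) \<and> (e \<in> H i \<longleftrightarrow> e \<in> H l)" if "e \<in> P" for e
    using typeP[OF that] P_ij[OF that] P_kl[OF that] by blast
  have sepQ: "(f \<in> H i \<longleftrightarrow> f \<notin> H j) \<and> (f \<in> H k \<longleftrightarrow> f \<notin> H l) \<and> (f \<in> H i \<longleftrightarrow> f \<in> H k)" if "f \<in> Q" for f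
    using key[OF e0 that i k] key[OF e1(1) that j(1) e1'(1) l(1) e1'(2)] Q_ij[OF that] Q_kl[OF that] by blast
  have sets: "P \<inter> H k = P \<inter> H j" "P \<inter> H l = P \<inter> H i" "Q \<inter> H k = Q \<inter> H i" "Q \<inter> H l = Q \<inter> H j"
    using sepP sepQ by auto
  have "card P = card (P \<inter> H i) + card (P \<inter> H j)" "card Q = card (Q \<inter> H i) + card (Q \<inter> H j)"
    using card_eq_sum_of_cover[OF fin(1), of "H i" "H j"] card_eq_sum_of_cover[OF fin(2), of "H i" "H j"]
      sepP sepQ by auto
  then have eq: "card (P \<inter> H m) = card (Q \<inter> H m)" if "m \<in> {i, j, k, l}" for m
    using le1[OF i(1)] le1[OF j(1)] le2[OF k(1)] le2[OF l(1)] that cQ unfolding sets by (auto simp: sets)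
  have tB1: "tight B1 m" if "tight X1 m" "m \<in> {i, j, k, l}" for m
    using card_Int_balance[OF b(1,3)[THEN finite_base], of "H m"] that eq[OF that(2)]
    unfolding tight_def P_def Q_def compatible_bases_Diff(2)[OF comp] by auto
  have tB2: "tight B2 m" if "tight X2 m" "m \<in> {i, j, k, l}" for m
    using card_Int_balance[OF b(2,4)[THEN finite_base], of "H m"] that eq[OF that(2)]
    unfolding tight_def P_def Q_def compatible_bases_Diff(1)[OF comp] by auto
  have "separate i j (P \<union> Q)" "separate k l (P \<union> Q)"
    unfolding separate_def using sepP sepQ by auto
  then have "aligned X1 X2 B1 B2 i j k l"
    using i(1) j(1) k(1) l(1) tB1 tB2 unfolding aligned_def P_def Q_def by simp
  moreover have "e0 \<in> H j" "f1 \<in> H l" using sepP[OF e0] sepQ[OF f1(1)] i f1 by auto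
  ultimately have "locked X1 X2 B1 B2 i j k l"
    using e0 e1 e1' f0 f1 f0i j(2) k(2) unfolding locked_def P_def Q_def by blast
  then show ?thesis by blast
qed

lemma descent_or_locked:
  assumes "compatible_bases I X1 X2 B1 B2" "X1 - B1 \<subseteq> N"
  shows "(\<exists>Y. descent I B1 (card (X1 - B1)) (X1, X2) Y) \<or> (\<exists>i j k l. locked X1 X2 B1 B2 i j k l)"
  using assms
proof (induction "card (X1 - B1)" arbitrary: X1 X2)
  case 0
  then show ?case using descent_refl by metis
next
  case (Suc n)
  note comp = Suc.prems(1) and PN = Suc.prems(2)
  note QN = Diff_subset_N(1)[OF comp PN]
  have b: "X1 \<in> bases I" "X2 \<in> bases I"
    using comp unfolding compatible_bases_def by blast+
  have ne: "X1 - B1 \<noteq> {}" using Suc.hyps(2) by (metis card.empty nat.distinct(1))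
  show ?case
  proof (cases "\<exists>e \<in> X1 - B1. \<exists>f \<in> X2 - B2. insert f (X1 - {e}) \<in> bases I \<and> insert e (X2 - {f}) \<in> bases I")
    case False
    have "stuck X1 X2 B1 B2"
      unfolding stuck_def
    proof (intro ballI)
      fix e f assume e: "e \<in> X1 - B1" and f: "f \<in> X2 - B2"
      have "e \<in> X1" "e \<notin> X2" "e \<in> N" "f \<in> X2" "f \<notin> X1" "f \<in> N"
        using e f PN QN compatible_bases_Diff[OF comp] by blast+
      then show "(\<exists>m. tight X1 m \<and> f \<in> H m \<and> e \<notin> H m) \<or> (\<exists>m. tight X2 m \<and> e \<in> H m \<and> f \<notin> H m)"
        using exchange_N[OF b(1), of e f] exchange_N[OF b(2), of f e] False e f by blast
    qed
    then show ?thesis using stuck_locked[OF comp PN ne] by blast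
  next
    case True
    \<comment> \<open>By induction, an exchange whose result is not locked extends to a full descent\<close>
    have good: ?thesis
      if "e \<in> X1 - B1" "f \<in> X2 - B2" "insert f (X1 - {e}) \<in> bases I" "insert e (X2 - {f}) \<in> bases I"
        "\<forall>i j k l. \<not> locked (insert f (X1 - {e})) (insert e (X2 - {f})) B1 B2 i j k l" for e f
    proof -
      note ex = exchange_step[OF comp that(1-4), unfolded fst_conv snd_conv] and unlocked = that(5)
      have "n = card (insert f (X1 - {e}) - B1)" using ex(4) Suc.hyps(2) by simp
      moreover have "insert f (X1 - {e}) - B1 \<subseteq> N" using ex(2) PN by blast
      ultimately obtain Y where "descent I B1 n (insert f (X1 - {e}), insert e (X2 - {f})) Y"
        using Suc.hyps(1)[of "insert f (X1 - {e})" "insert e (X2 - {f})"] ex(1) unlocked by metis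
      then show ?thesis using ex(5) Suc.hyps(2) by metis
    qed
    obtain e f where ef: "e \<in> X1 - B1" "f \<in> X2 - B2"
      "insert f (X1 - {e}) \<in> bases I" "insert e (X2 - {f}) \<in> bases I" using True by blast
    let ?Y1 = "insert f (X1 - {e})" and ?Y2 = "insert e (X2 - {f})"
    note ex = exchange_step[OF comp ef, unfolded fst_conv snd_conv]
    have YN: "?Y1 - B1 \<subseteq> N" using ex(2) PN by blast
    have el: "e \<in> X1" "e \<notin> X2" "e \<in> N" "e \<in> B2" "f \<in> X2" "f \<notin> X1" "f \<in> N" "f \<in> B1" "e \<noteq> f"
      using ef(1,2) PN QN compatible_bases_Diff[OF comp] by blast+
    show ?thesis
    proof (cases "\<exists>i j k l. locked ?Y1 ?Y2 B1 B2 i j k l")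
      case False
      then show ?thesis using good[OF ef] by blast
    next
      case True
      then obtain i j k l where lk: "locked ?Y1 ?Y2 B1 B2 i j k l" by blast
      consider "\<not> ((e \<in> H i \<longleftrightarrow> e \<notin> H j) \<and> (e \<in> H k \<longleftrightarrow> e \<notin> H l))"
        | "\<not> ((f \<in> H k \<longleftrightarrow> f \<notin> H l) \<and> (f \<in> H j \<longleftrightarrow> f \<notin> H i))"
        | "separate i j {e}" "separate k l {e}" "separate i j {f}" "separate k l {f}"
        unfolding separate_def by auto
      then show ?thesis
      proof cases
        case 1
        have "e \<in> ?Y2" "e \<notin> ?Y1" using el by auto
        from alternative_not_locked[OF ex(1) YN lk this(1) el(4) this(2) el(3) 1]
        obtain e' where e': "e' \<in> ?Y1 - B1" "insert e (?Y1 - {e'}) \<in> bases I" "insert e' (?Y2 - {e}) \<in> bases I"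
          "\<forall>i' j' k' l'. \<not> locked (insert e (?Y1 - {e'})) (insert e' (?Y2 - {e})) B1 B2 i' j' k' l'"
          by blast
        have e'X: "e' \<in> X1 - B1" "e' \<noteq> f" using e'(1) el(8) by auto
        then have "insert e (?Y1 - {e'}) = insert f (X1 - {e'})" "insert e' (?Y2 - {e}) = insert e' (X2 - {f})"
          using el e'(1) ex(2) by auto
        then show ?thesis using good[OF e'X(1) ef(2)] e' by simp
      next
        case 2
        have "f \<in> ?Y1" "f \<notin> ?Y2" using el by auto
        from alternative_not_locked[OF compatible_bases_swap[OF ex(1)] Diff_subset_N(1)[OF ex(1) YN]
          locked_swap[OF lk] this(1) el(8) this(2) el(7) 2]
        obtain f' where f': "f' \<in> ?Y2 - B2" "insert f (?Y2 - {f'}) \<in> bases I" "insert f' (?Y1 - {f}) \<in> bases I"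
          "\<forall>i' j' k' l'. \<not> locked (insert f (?Y2 - {f'})) (insert f' (?Y1 - {f})) B2 B1 i' j' k' l'"
          by blast
        have f'X: "f' \<in> X2 - B2" "f' \<noteq> e" using f'(1) el(4) by auto
        then have eqs: "insert f (?Y2 - {f'}) = insert e (X2 - {f'})" "insert f' (?Y1 - {f}) = insert f' (X1 - {e})"
          using el f'(1) ex(3) by auto
        have "\<not> locked (insert f' (X1 - {e})) (insert e (X2 - {f'})) B1 B2 i' j' k' l'" for i' j' k' l'
          using f'(4) locked_swap unfolding eqs by blast
        then show ?thesis using good[OF ef(1) f'X(1)] f'(2,3) unfolding eqs by blast
      next
        case 3
        then show ?thesis using locked_of_exchange[OF comp ef lk] by blast
      qed
    qed
  qed
qed

section \<open>Long descents from locked pairs\<close>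

lemma card_Int_N:
  assumes comp: "compatible_bases I X1 X2 B1 B2" and PN: "X1 - B1 \<subseteq> N"
  shows "card (X1 \<inter> B1 \<inter> N) + card (X1 - B1) = \<rho>"
    and "card (X2 \<inter> B2 \<inter> N) + card (X1 - B1) = \<rho>"
proof -
  have *: "card (X \<inter> B \<inter> N) + card (X - B) = \<rho>" if "X \<in> bases I" "X - B \<subseteq> N" for X B
  proof -
    have "(X \<inter> B \<inter> N) \<union> (X - B) = X \<inter> N" using that(2) by blast
    moreover have "card ((X \<inter> B \<inter> N) \<union> (X - B)) = card (X \<inter> B \<inter> N) + card (X - B)"
      using finite_base[OF that(1)] by (intro card_Un_disjoint) auto
    ultimately show ?thesis using card_base_N[OF that(1)] by simp
  qed
  have b: "X1 \<in> bases I" "X2 \<in> bases I" using comp unfolding compatible_bases_def by blast+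
  show "card (X1 \<inter> B1 \<inter> N) + card (X1 - B1) = \<rho>" using * b PN by blast
  show "card (X2 \<inter> B2 \<inter> N) + card (X1 - B1) = \<rho>"
    using *[OF b(2) Diff_subset_N(1)[OF comp PN]] Diff_subset_N(2)[OF comp PN] by simp
qed

text \<open>The sets \<open>H i\<close> and \<open>H j\<close> overlap only inside both \<open>X\<close> and \<open>B\<close>.\<close>

lemma tight_pair_sum:
  assumes "X \<in> bases I" "B \<in> bases I" "tight X i" "tight X j" "tight B i" "tight B j" "i \<noteq> j"
  shows "rs i + rs j \<le> \<rho> + card (X \<inter> B \<inter> N)"
proof -
  have HN: "H i \<subseteq> N" "H j \<subseteq> N" using assms H_subset unfolding tight_def by auto
  have fin: "finite X" using assms finite_base by blast
  have "card (X \<inter> H i) + card (X \<inter> H j) =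
      card ((X \<inter> H i) \<union> (X \<inter> H j)) + card ((X \<inter> H i) \<inter> (X \<inter> H j))"
    using fin by (intro card_Un_Int) auto
  moreover have "card ((X \<inter> H i) \<union> (X \<inter> H j)) \<le> card (X \<inter> N)"
    using fin HN by (intro card_mono) auto
  moreover have "card ((X \<inter> H i) \<inter> (X \<inter> H j)) \<le> card (X \<inter> B \<inter> N)"
    using fin HN tight_pair_bound(3)[OF base_indep[OF assms(2)] assms(5-7)] by (intro card_mono) auto
  ultimately show ?thesis using assms(3,4) card_base_N[OF assms(1)] unfolding tight_def by linarith
qed

text \<open>
  Each of the \<open>2 d\<close> elements of \<open>W\<close> lies in exactly one of the four intersections. Summing
  \<open>card_H_Int\<close> over them and bounding \<open>rs i + rs j\<close> and \<open>rs k + rs l\<close> by \<open>tight_pair_sum\<close> gives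
  \<open>2 d \<le> 4 |X1 \<inter> B1 \<inter> N|\<close>.
\<close>

lemma locked_bound:
  assumes comp: "compatible_bases I X1 X2 B1 B2" and PN: "X1 - B1 \<subseteq> N"
    and lk: "locked X1 X2 B1 B2 i j k l"
  shows "card (X1 - B1) \<le> 2 * card (X1 \<inter> B1 \<inter> N)"
proof -
  have b: "X1 \<in> bases I" "X2 \<in> bases I" "B1 \<in> bases I" "B2 \<in> bases I"
    using comp unfolding compatible_bases_def by blast+
  define W where "W = (X1 - B1) \<union> (X2 - B2)"
  have finW: "finite W" using b finite_base unfolding W_def by blast
  have al: "aligned X1 X2 B1 B2 i j k l" using lk unfolding locked_def by blast
  have t: "tight X1 i" "tight X1 j" "tight B1 i" "tight B1 j"
      "tight X2 k" "tight X2 l" "tight B2 k" "tight B2 l"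
    using al unfolding aligned_def by auto
  have sep: "\<And>x. x \<in> W \<Longrightarrow> x \<in> H i \<longleftrightarrow> x \<notin> H j" "\<And>x. x \<in> W \<Longrightarrow> x \<in> H k \<longleftrightarrow> x \<notin> H l"
    using al unfolding aligned_def separate_def W_def by auto
  obtain p q where p: "p \<in> W" "p \<in> H j" "p \<in> H k" and q: "q \<in> W" "q \<in> H j" "q \<in> H l"
    using lk unfolding locked_def W_def by auto
  obtain p' q' where p': "p' \<in> W" "p' \<in> H i" "p' \<in> H l" and q': "q' \<in> W" "q' \<in> H i" "q' \<in> H k"
    using lk unfolding locked_def W_def by auto
  have ne: "i \<noteq> j" "k \<noteq> l" "i \<noteq> k" "i \<noteq> l" "j \<noteq> k" "j \<noteq> l"
    using sep p q p' q' by auto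
  have "(X1 - B1) \<inter> (X2 - B2) = {}" using compatible_bases_Diff[OF comp] by blast
  then have cW: "card W = 2 * card (X1 - B1)"
    using Diff_subset_N(2)[OF comp PN] b finite_base unfolding W_def by (simp add: card_Un_disjoint)
  have "card W = card (W \<inter> H i \<inter> H k) + card (W \<inter> H i \<inter> H l) + (card (W \<inter> H j \<inter> H k) + card (W \<inter> H j \<inter> H l))"
    using card_eq_sum_of_cover[of W "H i" "H j"] card_eq_sum_of_cover[of "W \<inter> H i" "H k" "H l"]
      card_eq_sum_of_cover[of "W \<inter> H j" "H k" "H l"] finW sep by simp
  moreover have "card (W \<inter> H m \<inter> H n) + \<rho> \<le> rs m + rs n" if "m \<in> J" "n \<in> J" "m \<noteq> n" for m n
  proof -
    have "card (W \<inter> H m \<inter> H n) \<le> card (H m \<inter> H n)"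
      using finite_subset[OF H_subset[OF that(1)] finite_N] by (intro card_mono) auto
    then show ?thesis using card_H_Int[OF that] by simp
  qed
  from this[of i k] this[of i l] this[of j k] this[of j l]
  have "card (W \<inter> H i \<inter> H k) + \<rho> \<le> rs i + rs k" "card (W \<inter> H i \<inter> H l) + \<rho> \<le> rs i + rs l"
    "card (W \<inter> H j \<inter> H k) + \<rho> \<le> rs j + rs k" "card (W \<inter> H j \<inter> H l) + \<rho> \<le> rs j + rs l"
    using t ne unfolding tight_def by auto
  moreover note tight_pair_sum[OF b(1,3) t(1-4) ne(1)] tight_pair_sum[OF b(2,4) t(5-8) ne(2)] card_Int_N[OF comp PN]
  ultimately show ?thesis using cW by linarith
qed

text \<open>
  An exchange between elements of equal type is admissible in an aligned pair, since the only tight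
  set that could forbid it contains both elements or neither, and the result is aligned again.
\<close>

lemma aligned_descent:
  assumes "finite T" "compatible_bases I X1 X2 B1 B2" "X1 - B1 \<subseteq> N" "aligned X1 X2 B1 B2 i j k l"
    "T \<subseteq> X1 - B1" "\<phi> ` T \<subseteq> X2 - B2" "inj_on \<phi> T"
    "\<And>e m. e \<in> T \<Longrightarrow> m \<in> {i, j, k, l} \<Longrightarrow> e \<in> H m \<longleftrightarrow> \<phi> e \<in> H m"
  shows "\<exists>Y. descent I B1 (card T) (X1, X2) Y"
  using assms
proof (induction arbitrary: X1 X2 rule: finite_induct)
  case empty
  then show ?case using descent_refl by (metis card.empty)
next
  case (insert e T)
  note comp = insert.prems(1) and PN = insert.prems(2) and al = insert.prems(3)
  note QN = Diff_subset_N(1)[OF comp PN]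
  have b: "X1 \<in> bases I" "X2 \<in> bases I" using comp unfolding compatible_bases_def by blast+
  define f where "f = \<phi> e"
  have e: "e \<in> X1 - B1" and f: "f \<in> X2 - B2" using insert.prems unfolding f_def by auto
  have el: "e \<in> X1" "e \<notin> X2" "e \<in> N" "f \<in> X2" "f \<notin> X1" "f \<in> N"
    using e f PN QN compatible_bases_Diff[OF comp] by blast+
  have same: "e \<in> H m \<longleftrightarrow> f \<in> H m" if "m \<in> {i, j, k, l}" for m
    using insert.prems(7)[of e m] that unfolding f_def by blast
  have t: "tight X1 i" "tight X1 j" "tight X2 k" "tight X2 l"
    using al unfolding aligned_def by auto
  have sep: "separate i j (X1 - B1 \<union> (X2 - B2))" "separate k l (X1 - B1 \<union> (X2 - B2))"
    using al unfolding aligned_def by auto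
  have fij: "f \<in> H i \<or> f \<in> H j" and ekl: "e \<in> H k \<or> e \<in> H l"
    using sep e f unfolding separate_def by auto
  have Y1: "insert f (X1 - {e}) \<in> bases I"
  proof (rule exchange_N[OF b(1) el(1,5,3,6)])
    fix m assume m: "tight X1 m" "f \<in> H m"
    have "m = i \<or> m = j"
      using fij tight_unique[OF b(1) m(1) t(1) el(5) m(2)] tight_unique[OF b(1) m(1) t(2) el(5) m(2)] by blast
    then show "e \<in> H m" using same[of m] m by auto
  qed
  have Y2: "insert e (X2 - {f}) \<in> bases I"
  proof (rule exchange_N[OF b(2) el(4,2,6,3)])
    fix m assume m: "tight X2 m" "e \<in> H m"
    have "m = k \<or> m = l"
      using ekl tight_unique[OF b(2) m(1) t(3) el(2) m(2)] tight_unique[OF b(2) m(1) t(4) el(2) m(2)] by blast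
    then show "f \<in> H m" using same[of m] m by auto
  qed
  note ex = exchange_step[OF comp e f Y1 Y2, unfolded fst_conv snd_conv]
  have t': "tight (insert f (X1 - {e})) i" "tight (insert f (X1 - {e})) j"
    "tight (insert e (X2 - {f})) k" "tight (insert e (X2 - {f})) l"
    using t tight_exchange_same[OF b(1) el(1,5)] tight_exchange_same[OF b(2) el(4,2)] same by auto
  have "separate i j (insert f (X1 - {e}) - B1 \<union> (insert e (X2 - {f}) - B2))"
    "separate k l (insert f (X1 - {e}) - B1 \<union> (insert e (X2 - {f}) - B2))"
    using sep unfolding ex(2,3) separate_def by auto
  then have al': "aligned (insert f (X1 - {e})) (insert e (X2 - {f})) B1 B2 i j k l"
    using al t' unfolding aligned_def by auto
  have "insert f (X1 - {e}) - B1 \<subseteq> N" using ex(2) PN by blast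
  moreover have "T \<subseteq> insert f (X1 - {e}) - B1"
    unfolding ex(2) using insert.prems(4) insert.hyps(2) by blast
  moreover have "\<phi> ` T \<subseteq> insert e (X2 - {f}) - B2"
  proof -
    have "\<phi> e \<notin> \<phi> ` T" using insert.prems(6) insert.hyps(2) by (simp add: inj_on_insert)
    then show ?thesis unfolding ex(3) f_def using insert.prems(5) by blast
  qed
  moreover have "inj_on \<phi> T" using insert.prems(6) by simp
  moreover have "\<And>e m. e \<in> T \<Longrightarrow> m \<in> {i, j, k, l} \<Longrightarrow> e \<in> H m \<longleftrightarrow> \<phi> e \<in> H m"
    using insert.prems(7) by blast
  ultimately obtain Y where "descent I B1 (card T) (insert f (X1 - {e}), insert e (X2 - {f})) Y"
    using insert.IH[OF ex(1) _ al'] by blast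
  then show ?case using ex(5) insert.hyps by (metis card_insert_disjoint)
qed

text \<open>
  The exchange bijection respects types where it maps \<open>X1 - B1\<close> into \<open>X2 - B2\<close>. The other elements of
  \<open>X1 - B1\<close> go to \<open>X2 \<inter> B2\<close>, and stay within \<open>N\<close>, so there are few of them.
\<close>

lemma base_orderable_descent:
  assumes comp: "compatible_bases I X1 X2 B1 B2" and PN: "X1 - B1 \<subseteq> N"
    and lk: "locked X1 X2 B1 B2 i j k l" and bo: "base_orderable I"
  shows "\<exists>n Y. descent I B1 n (X1, X2) Y \<and> card (X1 - B1) \<le> n + card (X1 \<inter> B1 \<inter> N)"
proof -
  have b: "X1 \<in> bases I" "X2 \<in> bases I" using comp unfolding compatible_bases_def by blast+
  note fin = b[THEN finite_base]
  have al: "aligned X1 X2 B1 B2 i j k l" using lk unfolding locked_def by blast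
  obtain \<phi> where \<phi>: "bij_betw \<phi> X1 X2" and ex: "\<And>e. e \<in> X1 \<Longrightarrow> insert (\<phi> e) (X1 - {e}) \<in> bases I"
      "\<And>e. e \<in> X1 \<Longrightarrow> insert e (X2 - {\<phi> e}) \<in> bases I"
    using bo b unfolding base_orderable_def by meson
  have inj: "inj_on \<phi> X1" and im: "\<And>e. e \<in> X1 \<Longrightarrow> \<phi> e \<in> X2"
    using \<phi> unfolding bij_betw_def by auto
  define T where "T = {e \<in> X1 - B1. \<phi> e \<in> X2 - B2}"
  have PX2: "e \<notin> X2" if "e \<in> X1 - B1" for e using that compatible_bases_Diff(1)[OF comp] by blast
  have same: "e \<in> H m \<longleftrightarrow> \<phi> e \<in> H m" if e: "e \<in> T" and m: "m \<in> {i, j, k, l}" for e m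
  proof -
    let ?f = "\<phi> e"
    have el: "e \<in> X1" "e \<notin> X2" "?f \<in> X2" "?f \<notin> X1" "e \<in> X1 - B1" "?f \<in> X2 - B2"
      using e PX2 compatible_bases_Diff(2)[OF comp] unfolding T_def by auto
    have t: "tight X1 i" "tight X1 j" "tight X2 k" "tight X2 l"
      using al unfolding aligned_def by auto
    have sep: "separate i j {e, ?f}" "separate k l {e, ?f}"
      using al el unfolding aligned_def separate_def by auto
    have "?f \<in> H i \<longrightarrow> e \<in> H i" "?f \<in> H j \<longrightarrow> e \<in> H j"
      using tight_exchange[OF b(1) ex(1)[OF el(1)] el(1,4)] t by auto
    moreover have "e \<in> H k \<longrightarrow> ?f \<in> H k" "e \<in> H l \<longrightarrow> ?f \<in> H l"
      using tight_exchange[OF b(2) ex(2)[OF el(1)] el(3,2)] t by auto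
    ultimately show ?thesis using sep m unfolding separate_def by auto
  qed
  have "\<phi> ` (X1 - B1 - T) \<subseteq> X2 \<inter> B2 \<inter> N"
  proof
    fix y assume "y \<in> \<phi> ` (X1 - B1 - T)"
    then obtain e where e: "e \<in> X1 - B1" "e \<notin> T" "y = \<phi> e" by blast
    then have y: "y \<in> X2" "y \<in> B2" using im unfolding T_def by auto
    have eX: "e \<in> X1" "e \<notin> X2" "e \<in> N" using e PX2 PN by auto
    have "y \<notin> X1"
    proof
      assume "y \<in> X1"
      moreover have "y \<noteq> e" using y eX by blast
      ultimately have "insert y (X1 - {e}) = X1 - {e}" by blast
      then have "card (X1 - {e}) = card X1" using ex(1)[OF eX(1)] e(3) b(1) card_base by simp
      then show False using card_Diff1_less[OF fin(1) eX(1)] by simp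
    qed
    then have "y \<in> N"
      using card_exchange[OF fin(1) eX(1), of y N] ex(1)[OF eX(1)] e(3) eX(3) b(1) card_base_N
      by (cases "y \<in> N") auto
    then show "y \<in> X2 \<inter> B2 \<inter> N" using y by blast
  qed
  then have "card (\<phi> ` (X1 - B1 - T)) \<le> card (X2 \<inter> B2 \<inter> N)" using fin by (intro card_mono) auto
  moreover have "card (\<phi> ` (X1 - B1 - T)) = card (X1 - B1 - T)"
    using inj by (intro card_image) (auto intro: inj_on_subset)
  moreover have "card (X1 - B1) = card T + card (X1 - B1 - T)"
  proof -
    have "T \<subseteq> X1 - B1" unfolding T_def by blast
    then show ?thesis using fin by (metis card_Diff_subset card_mono finite_Diff finite_subset le_add_diff_inverse)
  qed
  moreover have "card (X2 \<inter> B2 \<inter> N) = card (X1 \<inter> B1 \<inter> N)" using card_Int_N[OF comp PN] by simp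
  ultimately have le: "card (X1 - B1) \<le> card T + card (X1 \<inter> B1 \<inter> N)" by simp
  have "finite T" "T \<subseteq> X1 - B1" "\<phi> ` T \<subseteq> X2 - B2" "inj_on \<phi> T"
    using fin inj unfolding T_def by (auto intro: inj_on_subset)
  then obtain Y where "descent I B1 (card T) (X1, X2) Y"
    using aligned_descent[OF _ comp PN al] same by blast
  then show ?thesis using le by blast
qed

text \<open>
  In a uniform summand \<open>C\<close> both \<open>X1\<close> and \<open>B1\<close> have \<open>cap C\<close> elements, so an \<open>e\<close> to be removed there has a
  partner \<open>f\<close> in the same summand, and every such exchange is admissible.
\<close>

lemma outer_descent:
  assumes "compatible_bases I X1 X2 B1 B2"
  shows "\<exists>n Z1 Z2. descent I B1 n (X1, X2) (Z1, Z2) \<and> compatible_bases I Z1 Z2 B1 B2 \<and>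
    Z1 - B1 \<subseteq> N \<and> Z1 \<inter> N = X1 \<inter> N \<and> card (X1 - B1) = n + card (Z1 - B1)"
  using assms
proof (induction "card (X1 - B1)" arbitrary: X1 X2 rule: less_induct)
  case less
  note comp = less.prems
  have b: "X1 \<in> bases I" "X2 \<in> bases I" "B1 \<in> bases I"
    using comp unfolding compatible_bases_def by blast+
  note fin = b[THEN finite_base]
  show ?case
  proof (cases "X1 - B1 \<subseteq> N")
    case True
    then show ?thesis using descent_refl comp by fastforce
  next
    case False
    then obtain e where e: "e \<in> X1 - B1" "e \<notin> N" by blast
    then have "e \<in> S" using b base_indep indep_subset_ground by blast
    then obtain C where C: "C \<in> \<C>" "e \<in> C" using e cover by blast
    have "card ((B1 - X1) \<inter> C) = card ((X1 - B1) \<inter> C)"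
      using card_Int_balance[OF fin(1,3), of C] card_base_block[OF _ C(1)] b by simp
    moreover have "card ((X1 - B1) \<inter> C) > 0" using e C fin by (auto simp: card_gt_0_iff)
    ultimately have "(B1 - X1) \<inter> C \<noteq> {}" by force
    then obtain f where f: "f \<in> X2 - B2" "f \<in> C" using compatible_bases_Diff(2)[OF comp] by blast
    have el: "e \<in> X1" "e \<notin> X2" "f \<in> X2" "f \<notin> X1"
      using e f compatible_bases_Diff[OF comp] by blast+
    have fN: "f \<notin> N" using f C disjoint_N by blast
    note Y = exchange_block[OF b(1) el(1,4) C f(2)] exchange_block[OF b(2) el(3,2) C(1) f(2) C(2)]
    note ex = exchange_step[OF comp e(1) f(1) Y, unfolded fst_conv snd_conv]
    have smaller: "card (insert f (X1 - {e}) - B1) < card (X1 - B1)" using ex(4) by simp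
    obtain n Z1 Z2 where Z: "descent I B1 n (insert f (X1 - {e}), insert e (X2 - {f})) (Z1, Z2)"
      "compatible_bases I Z1 Z2 B1 B2" "Z1 - B1 \<subseteq> N" "Z1 \<inter> N = insert f (X1 - {e}) \<inter> N"
      "card (insert f (X1 - {e}) - B1) = n + card (Z1 - B1)"
      using less.hyps[OF smaller ex(1)] by blast
    have "insert f (X1 - {e}) \<inter> N = X1 \<inter> N" using e(2) fN by auto
    then have "Z1 \<inter> N = X1 \<inter> N" using Z(4) by simp
    moreover have "card (X1 - B1) = Suc n + card (Z1 - B1)" using Z(5) ex(4) by simp
    ultimately show ?thesis
      using ex(5)[OF Z(1)] Z(2,3) by (intro exI[of _ "Suc n"] exI[of _ Z1] exI[of _ Z2]) simp
  qed
qed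

lemma split_descent:
  assumes comp: "compatible_bases I X1 X2 B1 B2"
  shows "\<exists>n Y. descent I B1 n (X1, X2) Y \<and> card (X1 - B1) \<le> n + 2 * card (X1 \<inter> B1)"
    and "base_orderable I \<Longrightarrow>
      \<exists>n Y. descent I B1 n (X1, X2) Y \<and> card (X1 - B1) \<le> n + card (X1 \<inter> B1)"
proof -
  obtain m Z1 Z2 where Z: "descent I B1 m (X1, X2) (Z1, Z2)" "compatible_bases I Z1 Z2 B1 B2"
    "Z1 - B1 \<subseteq> N" "Z1 \<inter> N = X1 \<inter> N" "card (X1 - B1) = m + card (Z1 - B1)"
    using outer_descent[OF comp] by blast
  have "finite X1" using comp finite_base unfolding compatible_bases_def by blast
  moreover have "Z1 \<inter> B1 \<inter> N \<subseteq> X1 \<inter> B1" using Z(4) by blast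
  ultimately have a: "card (Z1 \<inter> B1 \<inter> N) \<le> card (X1 \<inter> B1)" by (intro card_mono) auto
  consider Y where "descent I B1 (card (Z1 - B1)) (Z1, Z2) Y" | i j k l where "locked Z1 Z2 B1 B2 i j k l"
    using descent_or_locked[OF Z(2,3)] by blast
  then have "(\<exists>n Y. descent I B1 n (X1, X2) Y \<and> card (X1 - B1) \<le> n + 2 * card (X1 \<inter> B1)) \<and>
    (base_orderable I \<longrightarrow> (\<exists>n Y. descent I B1 n (X1, X2) Y \<and> card (X1 - B1) \<le> n + card (X1 \<inter> B1)))"
  proof cases
    case 1
    have "descent I B1 (card (X1 - B1)) (X1, X2) Y" using descent_trans[OF Z(1) 1] Z(5) by simp
    then show ?thesis using le_add1 by blast
  next
    case 2
    have "card (X1 - B1) \<le> m + 2 * card (X1 \<inter> B1)" using locked_bound[OF Z(2,3) 2] Z(5) a by linarith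
    moreover have "\<exists>n Y. descent I B1 n (X1, X2) Y \<and> card (X1 - B1) \<le> n + card (X1 \<inter> B1)"
      if bo: "base_orderable I"
    proof -
      obtain n Y where Y: "descent I B1 n (Z1, Z2) Y" "card (Z1 - B1) \<le> n + card (Z1 \<inter> B1 \<inter> N)"
        using base_orderable_descent[OF Z(2,3) 2 bo] by blast
      have "card (X1 - B1) \<le> (m + n) + card (X1 \<inter> B1)" using Y(2) Z(5) a by linarith
      then show ?thesis using descent_trans[OF Z(1) Y(1)] by blast
    qed
    ultimately show ?thesis using Z(1) by blast
  qed
  then show "\<exists>n Y. descent I B1 n (X1, X2) Y \<and> card (X1 - B1) \<le> n + 2 * card (X1 \<inter> B1)"
    and "base_orderable I \<Longrightarrow>
      \<exists>n Y. descent I B1 n (X1, X2) Y \<and> card (X1 - B1) \<le> n + card (X1 \<inter> B1)"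
    by blast+
qed

end

section \<open>Components of a split matroid\<close>

context matroid
begin

lemma contains_circuit:
  assumes "X \<subseteq> S" "X \<notin> I"
  shows "\<exists>D. circuit S I D \<and> D \<subseteq> X"
proof -
  have "finite X" using assms finite_ground finite_subset by blast
  then show ?thesis using assms
  proof (induction X rule: finite_psubset_induct)
    case (psubset X)
    show ?case
    proof (cases "\<exists>D. D \<subset> X \<and> D \<notin> I")
      case True
      then obtain D where D: "D \<subset> X" "D \<notin> I" by blast
      then obtain D' where "circuit S I D'" "D' \<subseteq> D" using psubset.IH[OF D(1)] psubset.prems by blast
      then show ?thesis using D by blast
    next
      case False
      then show ?thesis using psubset.prems unfolding circuit_def by blast
    qed
  qed
qed

abbreviation component_of :: "'a \<Rightarrow> 'a set" where
  "component_of x \<equiv> same_component S I `` {x}"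

lemma mem_component_of:
  "y \<in> component_of x \<longleftrightarrow> x \<in> S \<and> y \<in> S \<and> (x = y \<or> (\<exists>D. circuit S I D \<and> x \<in> D \<and> y \<in> D))"
  by (simp add: same_component_def)

lemma component_of_sym: "y \<in> component_of x \<longleftrightarrow> x \<in> component_of y"
  unfolding mem_component_of by auto

lemma component_of_subset: "component_of x \<subseteq> S"
  using mem_component_of by blast

lemma component_of_self: "x \<in> S \<Longrightarrow> x \<in> component_of x"
  using mem_component_of by blast

lemma circuit_subset_component: "circuit S I D \<Longrightarrow> x \<in> D \<Longrightarrow> D \<subseteq> component_of x"
proof
  fix y assume D: "circuit S I D" "x \<in> D" "y \<in> D"
  then have "x \<in> S" "y \<in> S" unfolding circuit_def by blast+
  then show "y \<in> component_of x" using D mem_component_of by blast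
qed

text \<open>
  In a uniform component with a circuit through two elements every set of the size of that circuit
  is a circuit. This instance of transitivity of \<open>same_component\<close> is what makes the components
  relevant here disjoint.
\<close>

lemma uniform_component:
  assumes un: "uniform (component_of x) (restriction I (component_of x))"
    and y: "y \<in> component_of x" and z: "z \<in> component_of x"
  shows "z \<in> component_of y"
proof (cases "y = z")
  case True
  then show ?thesis using y component_of_subset component_of_self by blast
next
  case False
  let ?C = "component_of x"
  obtain k where k: "restriction I ?C = {Y. Y \<subseteq> ?C \<and> card Y \<le> k}"
    using un unfolding uniform_def by blast
  have ind: "Y \<in> I \<longleftrightarrow> card Y \<le> k" if "Y \<subseteq> ?C" for Y
    using k that unfolding restriction_def by blast
  have finC: "finite ?C" using component_of_subset finite_ground finite_subset by blast
  obtain w where w: "w \<in> ?C" "w \<noteq> x" using y z False by blast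
  then obtain D where D: "circuit S I D" "x \<in> D" "w \<in> D"
    unfolding mem_component_of by auto
  have DC: "D \<subseteq> ?C" using circuit_subset_component D by blast
  have finD: "finite D" using DC finC finite_subset by blast
  have "k < card D" using D(1) ind[OF DC] unfolding circuit_def by auto
  moreover have "D - {x} \<in> I" using D(1,2) unfolding circuit_def by blast
  then have "card (D - {x}) \<le> k" using ind[of "D - {x}"] DC by blast
  ultimately have cD: "card D = Suc k" using D(2) finD by simp
  have "card {x, w} \<le> card D" using D finD by (intro card_mono) auto
  then have k2: "card {y, z} \<le> Suc k" using cD w(2) False by simp
  have yz: "{y, z} \<subseteq> ?C" using y z by blast
  have kC: "Suc k \<le> card ?C" using card_mono[OF finC DC] cD by simp
  obtain E where E: "{y, z} \<subseteq> E" "E \<subseteq> ?C" "card E = Suc k"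
    using exists_subset_between[OF k2 kC yz finC] by auto
  have finE: "finite E" using E(2) finC finite_subset by blast
  have "circuit S I E"
    unfolding circuit_def
  proof (intro conjI allI impI)
    show "E \<subseteq> S" using E(2) component_of_subset by blast
    show "E \<notin> I" using ind[OF E(2)] E(3) by simp
    fix D assume "D \<subset> E"
    then show "D \<in> I" using ind[of D] E(2,3) psubset_card_mono[OF finE, of D] by fastforce
  qed
  then show ?thesis using E circuit_subset_component by blast
qed

text \<open>
  \<open>N\<close> is the non-uniform component, or empty, and \<open>\<C>\<close> collects the uniform components outside it.
  Dependent sets contain circuits and a circuit stays within the component of each of its elements,
  so independence can be tested on \<open>N\<close> and on each member of \<open>\<C>\<close>.
\<close>

lemma split_matroid_presentation:
  assumes sm: "split_matroid S I"
  shows "\<exists>N \<rho> J H rs \<C> cap. split_presentation S I N \<rho> J H rs \<C> cap"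
proof -
  have comps: "matroid_components S I = component_of ` S"
    unfolding matroid_components_def quotient_def by blast
  let ?un = "\<lambda>C. uniform C (restriction I C)"
  have one: "component_of x = component_of y"
    if "x \<in> S" "y \<in> S" "\<not> ?un (component_of x)" "\<not> ?un (component_of y)" for x y
    using sm that unfolding split_matroid_def comps by blast
  define N where "N = \<Union> {component_of x | x. x \<in> S \<and> \<not> ?un (component_of x)}"
  have N_eq: "N = component_of x" if "x \<in> S" "\<not> ?un (component_of x)" for x
    using one that unfolding N_def by blast
  have es: "elementary_split N (restriction I N)"
  proof (cases "\<exists>x \<in> S. \<not> ?un (component_of x)")
    case True
    then obtain x where x: "x \<in> S" "\<not> ?un (component_of x)" by blast
    then have "elementary_split (component_of x) (restriction I (component_of x))"
      using sm unfolding split_matroid_def comps by blast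
    then show ?thesis using N_eq[OF x] by simp
  next
    case False
    then have "N = {}" unfolding N_def by blast
    moreover have "restriction I {} = {{}}" using indep_empty unfolding restriction_def by blast
    moreover have "elementary_split {} {{}}"
      unfolding elementary_split_def
      by (rule exI[of _ 0], rule exI[of _ 0], rule exI[of _ "\<lambda>_. 0"], rule exI[of _ "\<lambda>_. {}"]) auto
    ultimately show ?thesis by simp
  qed
  obtain \<rho> rs H and q :: nat where es': "\<rho> \<le> card N" "\<forall>i\<in>{1..q}. H i \<subseteq> N"
    "\<forall>i\<in>{1..q}. \<forall>j\<in>{1..q}. i < j \<longrightarrow> int (card (H i \<inter> H j)) \<le> int (rs i) + int (rs j) - int \<rho>"
    "\<forall>i\<in>{1..q}. \<rho> \<le> card (N - H i) + rs i"
    "restriction I N = {X. X \<subseteq> N \<and> card X \<le> \<rho> \<and> (\<forall>i\<in>{1..q}. card (X \<inter> H i) \<le> rs i)}"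
    using es unfolding elementary_split_def by - (elim exE conjE, rule that, assumption+)
  define \<C> where "\<C> = {component_of x | x. x \<in> S \<and> ?un (component_of x) \<and> \<not> component_of x \<subseteq> N}"
  have "\<exists>cap. \<forall>C \<in> \<C>. cap C \<le> card C \<and> restriction I C = {X. X \<subseteq> C \<and> card X \<le> cap C}"
    by (intro bchoice) (auto simp: \<C>_def uniform_def)
  then obtain cap where cap: "\<And>C. C \<in> \<C> \<Longrightarrow> cap C \<le> card C"
    "\<And>C. C \<in> \<C> \<Longrightarrow> restriction I C = {X. X \<subseteq> C \<and> card X \<le> cap C}" by blast
  have NS: "N \<subseteq> S" using component_of_subset unfolding N_def by blast
  \<comment> \<open>Disjointness: each member of \<open>\<C>\<close> is the component of any of its elements, none of which is in \<open>N\<close>.\<close>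
  have block: "C = component_of z" "?un C" "\<not> C \<subseteq> N" "z \<notin> N" if C: "C \<in> \<C>" "z \<in> C" for C z
  proof -
    obtain x where x: "x \<in> S" "?un (component_of x)" "\<not> component_of x \<subseteq> N" "C = component_of x"
      using C unfolding \<C>_def by blast
    show "?un C" "\<not> C \<subseteq> N" using x by auto
    have zS: "z \<in> S" using C(2) x(4) component_of_subset by blast
    have sub: "C \<subseteq> component_of z" using uniform_component[OF x(2)] C(2) x(4) by blast
    have unz: "?un (component_of z)"
    proof (rule ccontr)
      assume "\<not> ?thesis"
      then show False using N_eq[OF zS] sub x by blast
    qed
    show "C = component_of z"
    proof
      show "component_of z \<subseteq> C"
      proof
        fix w assume w: "w \<in> component_of z"
        have "x \<in> component_of z" using component_of_sym C(2) x(4) by blast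
        then show "w \<in> C" using uniform_component[OF unz _ w] x(4) by blast
      qed
    qed (rule sub)
    show "z \<notin> N"
    proof
      assume "z \<in> N"
      then obtain y where y: "y \<in> S" "\<not> ?un (component_of y)" "z \<in> component_of y"
        unfolding N_def by blast
      have "y \<in> component_of z" using y(3) component_of_sym by blast
      then have "component_of z \<subseteq> component_of y" using uniform_component[OF unz] by blast
      then show False using N_eq[OF y(1,2)] sub x by blast
    qed
  qed
  have cases: "component_of x = N \<or> component_of x \<subseteq> N \<or> component_of x \<in> \<C>" if "x \<in> S" for x
    using N_eq[OF that] that unfolding \<C>_def by blast
  have indep: "X \<in> I \<longleftrightarrow> X \<subseteq> S \<and> X \<inter> N \<in> I \<and> (\<forall>C \<in> \<C>. X \<inter> C \<in> I)" for X
  proof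
    assume "X \<in> I"
    then show "X \<subseteq> S \<and> X \<inter> N \<in> I \<and> (\<forall>C \<in> \<C>. X \<inter> C \<in> I)"
      using indep_subset_ground[of X] indep_subset[of X] by auto
  next
    assume R: "X \<subseteq> S \<and> X \<inter> N \<in> I \<and> (\<forall>C \<in> \<C>. X \<inter> C \<in> I)"
    show "X \<in> I"
    proof (rule ccontr)
      assume "X \<notin> I"
      then obtain D where D: "circuit S I D" "D \<subseteq> X" using contains_circuit[of X] R by blast
      have "D \<noteq> {}" using D(1) indep_empty unfolding circuit_def by blast
      then obtain x where x: "x \<in> D" by blast
      have sub: "D \<subseteq> component_of x" using circuit_subset_component[OF D(1) x] .
      have "x \<in> S" using D R x by blast
      then have "D \<subseteq> X \<inter> N \<or> (\<exists>C \<in> \<C>. D \<subseteq> X \<inter> C)" using cases[of x] sub D(2) by blast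
      then have "D \<in> I" using R indep_subset[of "X \<inter> _" D] by auto
      then show False using D(1) unfolding circuit_def by blast
    qed
  qed
  have "split_presentation S I N \<rho> {1..q} H rs \<C> cap"
  proof (unfold_locales)
    show "S = N \<union> \<Union> \<C>"
    proof
      show "S \<subseteq> N \<union> \<Union> \<C>" using cases component_of_self by blast
      show "N \<union> \<Union> \<C> \<subseteq> S" using NS component_of_subset unfolding \<C>_def by blast
    qed
    show "C \<inter> N = {}" if "C \<in> \<C>" for C using block(4)[OF that] by blast
    show "C \<inter> D = {}" if "C \<in> \<C>" "D \<in> \<C>" "C \<noteq> D" for C D
      using block(1)[OF that(1)] block(1)[OF that(2)] that(3) by blast
    show "H i \<subseteq> N" if "i \<in> {1..q}" for i using es'(2) that by blast
    show "card (H i \<inter> H j) + \<rho> \<le> rs i + rs j" if "i \<in> {1..q}" "j \<in> {1..q}" "i \<noteq> j" for i j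
    proof -
      have "int (card (H i \<inter> H j)) \<le> int (rs i) + int (rs j) - int \<rho>"
      proof (cases "i < j")
        case True
        then show ?thesis using es'(3) that by blast
      next
        case False
        then have "int (card (H j \<inter> H i)) \<le> int (rs j) + int (rs i) - int \<rho>" using es'(3) that by auto
        then show ?thesis by (simp add: Int_commute)
      qed
      then show ?thesis by linarith
    qed
    show "\<rho> \<le> card N" by (rule es'(1))
    show "\<rho> \<le> card (N - H i) + rs i" if "i \<in> {1..q}" for i using es'(4) that by blast
    show "cap C \<le> card C" if "C \<in> \<C>" for C using cap(1)[OF that] .
    fix X
    have "X \<inter> N \<in> I \<longleftrightarrow> X \<inter> N \<in> restriction I N" unfolding restriction_def by blast
    also have "\<dots> \<longleftrightarrow> card (X \<inter> N) \<le> \<rho> \<and> (\<forall>i\<in>{1..q}. card (X \<inter> H i) \<le> rs i)"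
    proof -
      have "X \<inter> N \<inter> H i = X \<inter> H i" if "i \<in> {1..q}" for i using es'(2) that by blast
      then show ?thesis unfolding es'(5) by simp
    qed
    finally have 1: "X \<inter> N \<in> I \<longleftrightarrow> card (X \<inter> N) \<le> \<rho> \<and> (\<forall>i\<in>{1..q}. card (X \<inter> H i) \<le> rs i)" .
    have 2: "X \<inter> C \<in> I \<longleftrightarrow> card (X \<inter> C) \<le> cap C" if "C \<in> \<C>" for C
    proof -
      have "X \<inter> C \<in> I \<longleftrightarrow> X \<inter> C \<in> restriction I C" unfolding restriction_def by blast
      then show ?thesis unfolding cap(2)[OF that] by simp
    qed
    show "X \<in> I \<longleftrightarrow> X \<subseteq> S \<and> card (X \<inter> N) \<le> \<rho> \<and> (\<forall>i\<in>{1..q}. card (X \<inter> H i) \<le> rs i) \<and>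
      (\<forall>C\<in>\<C>. card (X \<inter> C) \<le> cap C)"
      unfolding indep[of X] 1 using 2 by auto
  qed
  then show ?thesis by blast
qed

end

section \<open>Lengths of strictly monotone sequences\<close>

theorem theorem18:
  fixes S :: "'a set" and I :: "'a set set" and r :: nat
    and A\<^sub>1 A\<^sub>2 B\<^sub>1 B\<^sub>2 :: "'a set"
  assumes "matroid S I" and "mrank I = r"
    and "A\<^sub>1 \<in> bases I" and "A\<^sub>2 \<in> bases I" and "B\<^sub>1 \<in> bases I" and "B\<^sub>2 \<in> bases I"
    and "compatible (A\<^sub>1, A\<^sub>2) (B\<^sub>1, B\<^sub>2)"
  shows
    "(split_matroid S I \<longrightarrow>
       (\<exists>t P. strictly_monotone_seq I (A\<^sub>1, A\<^sub>2) (B\<^sub>1, B\<^sub>2) t P \<and>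
          int t \<ge> int r - 3 * int (card (A\<^sub>1 \<inter> B\<^sub>1)))) \<and>
     (base_orderable I \<and> split_matroid S I \<longrightarrow>
       (\<exists>t P. strictly_monotone_seq I (A\<^sub>1, A\<^sub>2) (B\<^sub>1, B\<^sub>2) t P \<and>
          int t \<ge> int r - 2 * int (card (A\<^sub>1 \<inter> B\<^sub>1)))) \<and>
     (paving S I \<longrightarrow>
       (\<exists>t P. strictly_monotone_seq I (A\<^sub>1, A\<^sub>2) (B\<^sub>1, B\<^sub>2) t P \<and>
          int t \<ge> int r - int (card (A\<^sub>1 \<inter> B\<^sub>1)) - 2))"
proof -
  interpret matroid S I by fact
  have comp: "compatible_bases I A\<^sub>1 A\<^sub>2 B\<^sub>1 B\<^sub>2"
    using assms unfolding compatible_bases_def compatible_def by simp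
  have r: "card (A\<^sub>1 - B\<^sub>1) + card (A\<^sub>1 \<inter> B\<^sub>1) = r" using card_Diff_base assms by simp
  have seq: "\<exists>t P. strictly_monotone_seq I (A\<^sub>1, A\<^sub>2) (B\<^sub>1, B\<^sub>2) t P \<and> int t \<ge> c"
    if "descent I B\<^sub>1 n (A\<^sub>1, A\<^sub>2) Y" "c \<le> int n" for c n Y
    using that strictly_monotone_seq_of_descent[of I "(B\<^sub>1, B\<^sub>2)"] by (metis fst_conv)
  show ?thesis
  proof (intro conjI impI; (elim conjE)?)
    assume "split_matroid S I"
    then obtain N \<rho> J H rs \<C> cap where "split_presentation S I N \<rho> J H rs \<C> cap"
      using split_matroid_presentation by blast
    then interpret split_presentation S I N \<rho> J H rs \<C> cap .
    obtain n Y where n: "descent I B\<^sub>1 n (A\<^sub>1, A\<^sub>2) Y" "card (A\<^sub>1 - B\<^sub>1) \<le> n + 2 * card (A\<^sub>1 \<inter> B\<^sub>1)"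
      using split_descent(1)[OF comp] by blast
    have "int r - 3 * int (card (A\<^sub>1 \<inter> B\<^sub>1)) \<le> int n" using n(2) r by linarith
    then show "\<exists>t P. strictly_monotone_seq I (A\<^sub>1, A\<^sub>2) (B\<^sub>1, B\<^sub>2) t P \<and>
        int t \<ge> int r - 3 * int (card (A\<^sub>1 \<inter> B\<^sub>1))"
      using seq[OF n(1)] by blast
  next
    assume bo: "base_orderable I" and "split_matroid S I"
    then obtain N \<rho> J H rs \<C> cap where "split_presentation S I N \<rho> J H rs \<C> cap"
      using split_matroid_presentation by blast
    then interpret split_presentation S I N \<rho> J H rs \<C> cap .
    obtain n Y where n: "descent I B\<^sub>1 n (A\<^sub>1, A\<^sub>2) Y" "card (A\<^sub>1 - B\<^sub>1) \<le> n + card (A\<^sub>1 \<inter> B\<^sub>1)"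
      using split_descent(2)[OF comp bo] by blast
    have "int r - 2 * int (card (A\<^sub>1 \<inter> B\<^sub>1)) \<le> int n" using n(2) r by linarith
    then show "\<exists>t P. strictly_monotone_seq I (A\<^sub>1, A\<^sub>2) (B\<^sub>1, B\<^sub>2) t P \<and>
        int t \<ge> int r - 2 * int (card (A\<^sub>1 \<inter> B\<^sub>1))"
      using seq[OF n(1)] by blast
  next
    assume "paving S I"
    then obtain n Y where n: "descent I B\<^sub>1 n (A\<^sub>1, A\<^sub>2) Y" "card (A\<^sub>1 - B\<^sub>1) \<le> n + 2"
      using paving_descent[OF _ comp] by blast
    have "int r - int (card (A\<^sub>1 \<inter> B\<^sub>1)) - 2 \<le> int n" using n(2) r by linarith
    then show "\<exists>t P. strictly_monotone_seq I (A\<^sub>1, A\<^sub>2) (B\<^sub>1, B\<^sub>2) t P \<and>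
        int t \<ge> int r - int (card (A\<^sub>1 \<inter> B\<^sub>1)) - 2"
      using seq[OF n(1)] by blast
  qed
qed

end
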